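(* Let $q$ be a prime power with $q\equiv 1\pmod 4$. The linear set $L_{\psi_{10}}$ is a maximum scattered $\mathbb{F}_q$-linear set of $\mathrm{PG}(1,q^{10})$ that is $\mathrm{P\Gamma L}$-equivalent neither to $L_f$ with $f(x)=x^{q^s}$, $1\le s\le 9$, $\gcd(s,10)=1$, nor to $L_f$ with $f(x)=\delta x^{q^s}+x^{q^{10-s}}$, $1\le s\le 9$, $\gcd(s,10)=1$, $\delta\in\mathbb{F}_{q^{10}}$, $\mathrm{N}_{q^{10}/q}(\delta)\notin\{0,1\}$.
   Context: $\psi_{10}(x)=\frac12\bigl(x^{q}+x^{q^{4}}-x^{q^{6}}+x^{q^{9}}\bigr)\in\mathbb{F}_{q^{10}}[x]$. For a $q$-polynomial $f$ (polynomial of the form $\sum_i c_ix^{q^i}$) over $\mathbb{F}_{q^n}$, $L_f=\{\langle (x,f(x))\rangle_{\mathbb{F}_{q^n}}: x\in\mathbb{F}_{q^n}^*\}\subseteq\mathrm{PG}(1,q^n)$; it is a linear set of rank $n$, called maximum scattered if it has $(q^n-1)/(q-1)$ points. $\mathrm{N}_{q^n/q}(\delta)=\delta^{(q^n-1)/(q-1)}$. Two linear sets of $\mathrm{PG}(1,q^n)$ are $\mathrm{P\Gamma L}$-equivalent if some element of $\mathrm{P\Gamma L}(2,q^n)$ maps one onto the other. Here $n=10$. *)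

theory Defs
  imports "HOL-Analysis.Analysis" "HOL-Computational_Algebra.Polynomial" "HOL-Number_Theory.Prime_Powers"
begin

text \<open>
  Throughout, the type \<open>'a\<close> is the field with \<open>q ^ n\<close> elements (the cardinality is assumed where
  it is needed), and \<open>'a ^ 2\<close> is the underlying vector space of the projective line over it.
\<close>

definition pg1_points :: "('a::field ^ 2) set set" where
  "pg1_points = {P. vec.subspace P \<and> vec.dim P = 1}"

text \<open>The subfield of order \<open>q\<close> of a finite field whose order is a power of \<open>q\<close>.\<close>

definition Fq :: "nat \<Rightarrow> 'a::field set" where
  "Fq q = {c. c ^ q = c}"

text \<open>\<open>U\<close> is a \<open>k\<close>-dimensional vector space over \<open>Fq q\<close>, i.e. it has an \<open>Fq q\<close>-basis
  \<open>b 0, \<dots>, b (k - 1)\<close>.\<close>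

definition Fq_subspace_of_dim :: "nat \<Rightarrow> nat \<Rightarrow> ('a::field ^ 2) set \<Rightarrow> bool" where
  "Fq_subspace_of_dim q k U \<longleftrightarrow>
    (\<exists>b :: nat \<Rightarrow> 'a ^ 2.
       U = {\<Sum>i<k. c i *s b i | c. \<forall>i<k. c i \<in> Fq q} \<and>
       (\<forall>c. (\<forall>i<k. c i \<in> Fq q) \<and> (\<Sum>i<k. c i *s b i) = 0 \<longrightarrow> (\<forall>i<k. c i = 0)))"

definition is_linear_set :: "nat \<Rightarrow> nat \<Rightarrow> ('a::field ^ 2) set set \<Rightarrow> bool" where
  "is_linear_set q k L \<longleftrightarrow>
    (\<exists>U. Fq_subspace_of_dim q k U \<and> L = {vec.span {u} | u. u \<in> U \<and> u \<noteq> 0})"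

text \<open>The division is exact.\<close>

definition maximum_scattered :: "nat \<Rightarrow> nat \<Rightarrow> ('a::field ^ 2) set set \<Rightarrow> bool" where
  "maximum_scattered q n L \<longleftrightarrow>
    is_linear_set q n L \<and> L \<subseteq> pg1_points \<and> card L = (q ^ n - 1) div (q - 1)"

definition lin_set :: "'a::field poly \<Rightarrow> ('a ^ 2) set set" where
  "lin_set f = {vec.span {vector [x, poly f x]} | x. x \<noteq> 0}"

definition field_norm :: "nat \<Rightarrow> nat \<Rightarrow> 'a::field \<Rightarrow> 'a" where
  "field_norm q n \<delta> = \<delta> ^ ((q ^ n - 1) div (q - 1))"

definition field_automorphism :: "('a::field \<Rightarrow> 'a) \<Rightarrow> bool" where
  "field_automorphism \<sigma> \<longleftrightarrow>
    bij \<sigma> \<and> \<sigma> 1 = 1 \<and> (\<forall>x y. \<sigma> (x + y) = \<sigma> x + \<sigma> y) \<and> (\<forall>x y. \<sigma> (x * y) = \<sigma> x * \<sigma> y)"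

definition GammaL2 :: "('a::field ^ 2 \<Rightarrow> 'a ^ 2) set" where
  "GammaL2 = {\<lambda>v. A *v (\<chi> i. \<sigma> (v $ i)) | (A :: 'a ^ 2 ^ 2) \<sigma>. invertible A \<and> field_automorphism \<sigma>}"

definition PGammaL2 :: "(('a::field ^ 2) set \<Rightarrow> ('a ^ 2) set) set" where
  "PGammaL2 = {restrict ((`) g) pg1_points | g. g \<in> GammaL2}"

definition PGammaL_equivalent :: "('a::field ^ 2) set set \<Rightarrow> ('a ^ 2) set set \<Rightarrow> bool" where
  "PGammaL_equivalent L M \<longleftrightarrow> (\<exists>\<phi>\<in>PGammaL2. \<phi> ` L = M)"

definition psi10 :: "nat \<Rightarrow> 'a::field poly" where
  "psi10 q = smult (1 / 2)
     (monom 1 q + monom 1 (q ^ 4) - monom 1 (q ^ 6) + monom 1 (q ^ 9))"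

end

theory Submission
  imports Defs "HOL-Number_Theory.Cong"
begin

text \<open>
  Write $x_i = x^{q^i}$. The element \<open>x\<close> splits as \<open>x = a + b\<close> with \<open>a\<close> in the subfield of order
  \<open>q ^ 5\<close> and \<open>b\<close> in the eigenspace of the involution \<open>y \<mapsto> y ^ (q ^ 5)\<close> for the eigenvalue \<open>- 1\<close>.
  In these coordinates \<open>\<psi>(a + b)\<close> is $a_{-1} + b_1$.

  \<^bold>\<open>Scatteredness.\<close> If \<open>\<psi>(l x) = l \<psi>(x)\<close> and \<open>v\<close> is the anti-invariant part of \<open>l\<close>, then comparing
  the two eigencomponents shows that $v (a a_{-1} - b b_1)$ is fixed by \<open>y \<mapsto> y ^ q\<close>. It is also
  anti-invariant, hence zero. The factor $a a_{-1} - b b_1$ does not vanish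
  (\<open>norm_form_neq_0\<close>): otherwise the quotient of the partial norms of \<open>a\<close> and \<open>b\<close> would be a square
  root of \<open>- 1\<close> outside the field of order \<open>q\<close>, which contains all of them because \<open>q \<equiv> 1\<close> modulo 4.
  So \<open>v = 0\<close>, and \<open>l\<close> lies in the field of order \<open>q\<close> (\<open>scattered\<close>).

  \<^bold>\<open>Inequivalence.\<close> A linear set of rank 10 with slopes \<open>f(x) / x\<close> is cut out by the determinant
  of the linear system $z_i x_i = f(x)_i$ $(0 \le i < 10)$ in the unknowns $x_i$. This is a multilinear
  form in ten vectors $w_i = (u_i, v_i)$, evaluated at $(1, z^{q^i})$; as a polynomial in \<open>z\<close> its
  degree is at most $1 + q + \dots + q^9$, the number of points of a maximum scattered set. Hence two
  nonzero multilinear forms vanishing on the same maximum scattered set are proportional, not only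
  along the curve $(1, z^{q^i})$ but as forms in ten independent vectors (\<open>multilinear_proportional\<close>). An
  equivalence of linear sets therefore forces one form to be a multiple of the other after an invertible
  linear substitution in each of the ten arguments separately.

  For \<open>\<psi>\<close> and for \<open>\<delta> x ^ (q ^ s) + x ^ (q ^ (10 - s))\<close> the determinants are given by products of
  2 by 2 matrices: the difference of the diagonal entries of such a product, respectively its trace
  corrected by a multiple of $u_0 \cdots u_9$ (\<open>psi_form\<close>, \<open>lp_form\<close>). Consider them as bilinear
  forms in the arguments 0 and 5, the other eight arguments being arbitrary constants. The form of \<open>\<psi>\<close> yields exactly the bilinear
  forms in the span of $u u'$, $v v'$ and $v u' - u v'$, a space of dimension 3. The second form yields
  all bilinear forms if \<open>\<delta> \<noteq> 0\<close>, and only combinations of $u u'$ and $v v'$ if \<open>\<delta> = 0\<close>. These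
  dimensions 3, 4 and 2 are invariant under the substitution, so there is no equivalence. The case
  \<open>\<delta> = 0\<close> covers the monomials \<open>x ^ (q ^ s)\<close>.
\<close>

section \<open>Finite fields and residues modulo 10\<close>

lemma power_card_eq_self:
  fixes x :: "'a::{field,finite}"
  shows "x ^ CARD('a) = x"
proof (cases "x = 0")
  case False
  have "(\<Prod>y\<in>UNIV-{0}. x * y) = (\<Prod>y\<in>UNIV-{0}. y)"
    by (rule prod.reindex_bij_witness[of _ "\<lambda>y. y / x" "\<lambda>y. x * y"]) (use False in auto)
  then have "x ^ (CARD('a) - 1) * (\<Prod>y\<in>UNIV-{0}. y) = 1 * (\<Prod>y::'a\<in>UNIV-{0}. y)"
    by (simp add: prod.distrib)
  moreover have "(\<Prod>y\<in>UNIV-{0}. y) \<noteq> (0::'a)" by simp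
  ultimately have "x ^ (CARD('a) - 1) = 1" by (metis mult_right_cancel)
  then show ?thesis
    using power_minus_mult[of "CARD('a)" x] finite_UNIV_card_ge_0[where ?'a = 'a] by simp
qed (simp add: finite_UNIV_card_ge_0)

text \<open>
  Translation by 1 permutes the field, so it does not change the sum of all elements.
\<close>
lemma of_nat_card_eq_0: "of_nat CARD('a) = (0::'a::{field,finite})"
proof -
  have "(\<Sum>x\<in>UNIV. x + (1::'a)) = (\<Sum>x\<in>UNIV. x)"
    by (rule sum.reindex_bij_witness[of _ "\<lambda>y. y - 1" "\<lambda>y. y + 1"]) auto
  then show ?thesis by (simp add: sum.distrib)
qed

lemma coprime_10_cases:
  assumes "1 \<le> s" "s \<le> 9" "gcd s 10 = (1::nat)" shows "s \<in> {1, 3, 7, 9}"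
proof -
  have "odd s"
  proof
    assume "even s"
    then have "2 dvd gcd s 10" by simp
    then show False using assms(3) by simp
  qed
  moreover have "s \<noteq> 5" using assms(3) by auto
  ultimately show ?thesis using assms(1,2) by (auto elim!: oddE)
qed

text \<open>
  The exponents of \<open>q\<close> that occur for the map \<open>x \<mapsto> \<delta> x ^ (q ^ s) + x ^ (q ^ (10 - s))\<close> are reached in steps
  of \<open>s\<close>. The steps visit every residue once, and the residue 5 stays opposite to 0.
\<close>
lemma multiples_mod_10:
  assumes "s \<in> {1, 3, 7, 9::nat}"
  shows "inj_on (\<lambda>p. s * p mod 10) {..<10}" "(\<lambda>p. s * p mod 10) ` {..<10} = {..<10}"
    "s * 5 mod 10 = 5" "(10 - s) mod 10 = s * 9 mod 10"
proof -
  have "coprime s 10" using assms by (auto simp: coprime_iff_gcd_eq_1 gcd_non_0_nat)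
  show inj: "inj_on (\<lambda>p. s * p mod 10) {..<10}"
  proof (rule inj_onI)
    fix x y assume xy: "x \<in> {..<10}" "y \<in> {..<10}" "s * x mod 10 = s * y mod 10"
    then have "[s * x = s * y] (mod 10)" by (simp add: cong_def)
    then have "[x = y] (mod 10)" using \<open>coprime s 10\<close> by (simp add: cong_mult_lcancel_nat)
    then show "x = y" using xy(1,2) by (simp add: cong_def)
  qed
  show "(\<lambda>p. s * p mod 10) ` {..<10} = {..<10}"
    by (rule endo_inj_surj[OF _ _ inj]) auto
  show "s * 5 mod 10 = 5" "(10 - s) mod 10 = s * 9 mod 10" using assms by auto
qed

section \<open>Multilinear forms in sequences of plane vectors\<close>

text \<open>
  The forms are functions of a sequence of vectors; only the arguments with index in \<open>S\<close> matter, and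
  linearity in each of them is expressed by expansion along the standard basis, so that no addition
  on pairs is needed.
\<close>

definition multilinear_on :: "nat set \<Rightarrow> ((nat \<Rightarrow> 'a \<times> 'a) \<Rightarrow> 'a::field) \<Rightarrow> bool" where
  "multilinear_on S f \<longleftrightarrow>
    (\<forall>w w'. (\<forall>i\<in>S. w i = w' i) \<longrightarrow> f w = f w') \<and>
    (\<forall>i\<in>S. \<forall>w. f w = fst (w i) * f (w(i := (1, 0))) + snd (w i) * f (w(i := (0, 1))))"

lemma multilinear_on_cong:
  "multilinear_on S f \<Longrightarrow> (\<And>i. i \<in> S \<Longrightarrow> w i = w' i) \<Longrightarrow> f w = f w'"
  unfolding multilinear_on_def by blast

lemma multilinear_on_expand:
  "multilinear_on S f \<Longrightarrow> i \<in> S \<Longrightarrow>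
    f w = fst (w i) * f (w(i := (1, 0))) + snd (w i) * f (w(i := (0, 1)))"
  unfolding multilinear_on_def by blast

lemma multilinear_onI:
  assumes "\<And>w w'. (\<And>i. i \<in> S \<Longrightarrow> w i = w' i) \<Longrightarrow> f w = f w'"
    and "\<And>i w. i \<in> S \<Longrightarrow> f w = fst (w i) * f (w(i := (1, 0))) + snd (w i) * f (w(i := (0, 1)))"
  shows "multilinear_on S f"
  using assms unfolding multilinear_on_def by blast

lemma multilinear_on_add:
  assumes "multilinear_on S f" "multilinear_on S g"
  shows "multilinear_on S (\<lambda>w. f w + g w)"
proof (rule multilinear_onI)
  fix w w' :: "nat \<Rightarrow> 'a \<times> 'a" assume "\<And>i. i \<in> S \<Longrightarrow> w i = w' i"
  then show "f w + g w = f w' + g w'"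
    using multilinear_on_cong[OF assms(1), of w w'] multilinear_on_cong[OF assms(2), of w w'] by simp
next
  fix i w assume "i \<in> S"
  note e = multilinear_on_expand[OF assms(1) this, of w] multilinear_on_expand[OF assms(2) this, of w]
  show "f w + g w = fst (w i) * (f (w(i := (1, 0))) + g (w(i := (1, 0)))) +
    snd (w i) * (f (w(i := (0, 1))) + g (w(i := (0, 1))))"
    by (subst e(1), subst e(2)) algebra
qed

lemma multilinear_on_scale:
  assumes "multilinear_on S f"
  shows "multilinear_on S (\<lambda>w. c * f w)"
proof (rule multilinear_onI)
  fix w w' :: "nat \<Rightarrow> 'a \<times> 'a" assume "\<And>i. i \<in> S \<Longrightarrow> w i = w' i"
  then show "c * f w = c * f w'" using multilinear_on_cong[OF assms, of w w'] by simp
next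
  fix i w assume "i \<in> S"
  note e = multilinear_on_expand[OF assms this, of w]
  show "c * f w = fst (w i) * (c * f (w(i := (1, 0)))) + snd (w i) * (c * f (w(i := (0, 1))))"
    by (subst e) algebra
qed

lemma multilinear_on_diff:
  assumes "multilinear_on S f" "multilinear_on S g"
  shows "multilinear_on S (\<lambda>w. f w - g w)"
  using multilinear_on_add[OF assms(1) multilinear_on_scale[OF assms(2), of "-1"]] by simp

lemma multilinear_on_zero: "multilinear_on S (\<lambda>w. 0)"
  by (simp add: multilinear_on_def)

lemma multilinear_on_fst: "multilinear_on {i} (\<lambda>w. fst (w i))"
  by (simp add: multilinear_on_def)

lemma multilinear_on_snd: "multilinear_on {i} (\<lambda>w. snd (w i))"
  by (simp add: multilinear_on_def)

lemma multilinear_on_mult: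
  assumes f: "multilinear_on S f" and g: "multilinear_on T g" and disj: "S \<inter> T = {}"
  shows "multilinear_on (S \<union> T) (\<lambda>w. f w * g w)"
proof (rule multilinear_onI)
  fix w w' :: "nat \<Rightarrow> 'a \<times> 'a" assume "\<And>i. i \<in> S \<union> T \<Longrightarrow> w i = w' i"
  then show "f w * g w = f w' * g w'"
    using multilinear_on_cong[OF f, of w w'] multilinear_on_cong[OF g, of w w'] by simp
next
  fix i w assume i: "i \<in> S \<union> T"
  show "f w * g w = fst (w i) * (f (w(i := (1, 0))) * g (w(i := (1, 0)))) +
      snd (w i) * (f (w(i := (0, 1))) * g (w(i := (0, 1))))"
  proof (cases "i \<in> S")
    case True
    then have "g (w(i := c)) = g w" for c
      using disj by (intro multilinear_on_cong[OF g]) auto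
    note g_upd = this
    show ?thesis unfolding g_upd by (subst multilinear_on_expand[OF f True, of w]) algebra
  next
    case False
    then have "f (w(i := c)) = f w" for c
      by (intro multilinear_on_cong[OF f]) auto
    note f_upd = this
    have "i \<in> T" using i False by simp
    show ?thesis unfolding f_upd by (subst multilinear_on_expand[OF g \<open>i \<in> T\<close>, of w]) algebra
  qed
qed

lemma multilinear_on_scale_args:
  assumes f: "multilinear_on S f" and "finite S"
  shows "f (\<lambda>i. (t i * fst (w i), t i * snd (w i))) = (\<Prod>i\<in>S. t i) * f w"
proof -
  have "finite T \<Longrightarrow> T \<subseteq> S \<Longrightarrow>
    f (\<lambda>i. if i \<in> T then (t i * fst (w i), t i * snd (w i)) else w i) = (\<Prod>i\<in>T. t i) * f w" for T
  proof (induction T rule: finite_induct)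
    case (insert j T)
    define v where "v = (\<lambda>i. if i \<in> T then (t i * fst (w i), t i * snd (w i)) else w i)"
    have j: "j \<in> S" using insert by auto
    have vj: "v j = w j" using insert by (simp add: v_def)
    have "(\<lambda>i. if i \<in> insert j T then (t i * fst (w i), t i * snd (w i)) else w i) =
      v(j := (t j * fst (w j), t j * snd (w j)))" by (auto simp: v_def)
    moreover have "f (v(j := (t j * fst (w j), t j * snd (w j)))) = t j * f v"
      using multilinear_on_expand[OF f j, of v]
        multilinear_on_expand[OF f j, of "v(j := (t j * fst (w j), t j * snd (w j)))"]
      by (simp add: vj algebra_simps)
    ultimately show ?case using insert by (simp add: v_def)
  qed simp
  from this[OF assms(2) order.refl]
  show ?thesis using multilinear_on_cong[OF f,
      of "\<lambda>i. if i \<in> S then (t i * fst (w i), t i * snd (w i)) else w i"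
         "\<lambda>i. (t i * fst (w i), t i * snd (w i))"] by simp
qed

lemma multilinear_on_subst:
  assumes f: "multilinear_on S f"
  shows "multilinear_on S (\<lambda>w. f (\<lambda>i. (a i * fst (w i) + b i * snd (w i), c i * fst (w i) + d i * snd (w i))))"
    (is "multilinear_on S (\<lambda>w. f (?m w))")
proof (rule multilinear_onI)
  fix w w' :: "nat \<Rightarrow> 'a \<times> 'a" assume "\<And>i. i \<in> S \<Longrightarrow> w i = w' i"
  then show "f (?m w) = f (?m w')" by (intro multilinear_on_cong[OF f]) simp
next
  fix i w assume i: "i \<in> S"
  define v where "v = ?m w"
  have upd: "?m (w(i := (1, 0))) = v(i := (a i, c i))" "?m (w(i := (0, 1))) = v(i := (b i, d i))"
    by (auto simp: v_def)
  have ex: "f u = fst (u i) * f (u(i := (1, 0))) + snd (u i) * f (u(i := (0, 1)))" for u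
    by (rule multilinear_on_expand[OF f i])
  show "f (?m w) = fst (w i) * f (?m (w(i := (1, 0)))) + snd (w i) * f (?m (w(i := (0, 1))))"
    unfolding upd ex[of "v(i := (a i, c i))"] ex[of "v(i := (b i, d i))"] v_def[symmetric] ex[of v]
    by (simp add: v_def algebra_simps)
qed


lemma multilinear_restrict:
  assumes "multilinear_on {..<Suc n} f"
  shows "multilinear_on {..<n} (\<lambda>w. f (w(n := c)))"
proof (rule multilinear_onI)
  fix w w' :: "nat \<Rightarrow> 'a \<times> 'a" assume "\<And>i. i \<in> {..<n} \<Longrightarrow> w i = w' i"
  then show "f (w(n := c)) = f (w'(n := c))" by (intro multilinear_on_cong[OF assms]) auto
next
  fix i w assume "i \<in> {..<n}"
  then have "i < n" by simp
  then show "f (w(n := c)) = fst (w i) * f ((w(i := (1, 0)))(n := c)) + snd (w i) * f ((w(i := (0, 1)))(n := c))"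
    using multilinear_on_expand[OF assms, of i "w(n := c)"] by (simp add: fun_upd_twist)
qed

text \<open>
  Along the curve \<open>z \<mapsto> (1, z ^ q ^ i)\<close> the monomials of a multilinear form become powers of \<open>z\<close> whose
  exponents have the digits 0 and 1 in base \<open>q\<close>. Distinct monomials give distinct exponents, so the
  polynomial determines the form.
\<close>
lemma multilinear_polynomial:
  fixes f :: "(nat \<Rightarrow> 'a \<times> 'a) \<Rightarrow> 'a::field"
  assumes q: "q > 1" and f: "multilinear_on {..<n} f"
  shows "\<exists>P. degree P \<le> (\<Sum>i<n. q ^ i) \<and> (\<forall>z. poly P z = f (\<lambda>i. (1, z ^ q ^ i))) \<and>
    (P = 0 \<longrightarrow> (\<forall>w. f w = 0))"
  using f
proof (induction n arbitrary: f)
  case 0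
  have const: "f w = f (\<lambda>_. (0, 0))" for w by (rule multilinear_on_cong[OF 0]) simp
  show ?case
    by (intro exI[of _ "[:f (\<lambda>_. (0, 0)):]"]) (auto intro: const[symmetric] trans[OF const])
next
  case (Suc n)
  define f0 f1 where "f0 = (\<lambda>w. f (w(n := (1, 0))))" and "f1 = (\<lambda>w. f (w(n := (0, 1))))"
  have split: "f w = fst (w n) * f0 w + snd (w n) * f1 w" for w
    unfolding f0_def f1_def by (rule multilinear_on_expand[OF Suc.prems]) simp
  obtain P0 P1 where P0: "degree P0 \<le> (\<Sum>i<n. q ^ i)" "\<And>z. poly P0 z = f0 (\<lambda>i. (1, z ^ q ^ i))"
      "P0 = 0 \<Longrightarrow> \<forall>w. f0 w = 0"
    and P1: "degree P1 \<le> (\<Sum>i<n. q ^ i)" "\<And>z. poly P1 z = f1 (\<lambda>i. (1, z ^ q ^ i))"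
      "P1 = 0 \<Longrightarrow> \<forall>w. f1 w = 0"
    using Suc.IH[of f0] Suc.IH[of f1] multilinear_restrict[OF Suc.prems] unfolding f0_def f1_def by metis
  have lt: "(\<Sum>i<n. q ^ i) < q ^ n"
  proof (induction n)
    case (Suc n)
    then have "(\<Sum>i<Suc n. q ^ i) < 2 * q ^ n" by simp
    also have "\<dots> \<le> q ^ Suc n" using q by simp
    finally show ?case .
  qed simp
  define P where "P = P0 + monom 1 (q ^ n) * P1"
  have "degree P \<le> (\<Sum>i<Suc n. q ^ i)"
    unfolding P_def using P0(1) P1(1)
    by (intro degree_add_le order.trans[OF degree_mult_le]) (auto simp: degree_monom_eq)
  moreover have "poly P z = f (\<lambda>i. (1, z ^ q ^ i))" for z
    using split[of "\<lambda>i. (1, z ^ q ^ i)"] by (simp add: P_def P0(2) P1(2) poly_monom)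
  moreover have "\<forall>w. f w = 0" if "P = 0"
  proof -
    have c: "coeff P k = coeff P0 k + (if q ^ n \<le> k then coeff P1 (k - q ^ n) else 0)" for k
      by (simp add: P_def coeff_monom_mult)
    have "P0 = 0"
    proof (rule poly_eqI)
      fix k show "coeff P0 k = coeff 0 k"
      proof (cases "q ^ n \<le> k")
        case True
        then show ?thesis using lt P0(1) by (simp add: coeff_eq_0)
      next
        case False then show ?thesis using c[of k] that by simp
      qed
    qed
    moreover have "P1 = 0"
    proof (rule poly_eqI)
      fix k show "coeff P1 k = coeff 0 k"
        using c[of "k + q ^ n"] that \<open>P0 = 0\<close> by simp
    qed
    ultimately show ?thesis using split P0(3) P1(3) by simp
  qed
  ultimately show ?case by blast
qed

text \<open>
  A suitable combination of the two polynomials has its coefficient at the largest possible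
  exponent cancelled and keeps all the roots in \<open>Z\<close>. These are more than its degree, so it is zero.
  As \<open>CARD('a)\<close> exceeds the degree, nothing is lost in passing between polynomials and functions.
\<close>
lemma multilinear_proportional:
  fixes f g :: "(nat \<Rightarrow> 'a \<times> 'a) \<Rightarrow> 'a::{field,finite}"
  assumes q: "q > 1" and big: "(\<Sum>i<n. q ^ i) < CARD('a)"
    and f: "multilinear_on {..<n} f" and g: "multilinear_on {..<n} g"
    and Z: "card Z = (\<Sum>i<n. q ^ i)"
    and f0: "\<And>z. z \<in> Z \<Longrightarrow> f (\<lambda>i. (1, z ^ q ^ i)) = 0"
    and g0: "\<And>z. z \<in> Z \<Longrightarrow> g (\<lambda>i. (1, z ^ q ^ i)) = 0"
    and nz: "g w0 \<noteq> 0"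
  shows "\<exists>c. \<forall>w. f w = c * g w"
proof -
  let ?d = "\<Sum>i<n. q ^ i"
  have few_roots: "P = 0" if "degree P \<le> ?d" "coeff P ?d = 0" "\<And>z. z \<in> Z \<Longrightarrow> poly P z = 0" for P :: "'a poly"
  proof (rule ccontr)
    assume P: "P \<noteq> 0"
    then have "degree P \<noteq> ?d" using that(2) by (metis leading_coeff_0_iff)
    then have "degree P < card Z" using that(1) Z by simp
    moreover have "card Z \<le> card {z. poly P z = 0}"
      using that(3) poly_roots_finite[OF P] by (intro card_mono) auto
    ultimately show False using card_poly_roots_bound[OF P] by simp
  qed
  obtain P where P: "degree P \<le> ?d" "\<And>z. poly P z = f (\<lambda>i. (1, z ^ q ^ i))"
    using multilinear_polynomial[OF q f] by blast
  obtain R where R: "degree R \<le> ?d" "\<And>z. poly R z = g (\<lambda>i. (1, z ^ q ^ i))" "R = 0 \<Longrightarrow> \<forall>w. g w = 0"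
    using multilinear_polynomial[OF q g] by blast
  \<comment> \<open>otherwise \<open>R\<close> would vanish and with it the form \<open>g\<close>\<close>
  have "coeff R ?d \<noteq> 0" using few_roots[of R] R g0 nz by auto
  define c where "c = coeff P ?d / coeff R ?d"
  have "P - smult c R = 0"
    by (rule few_roots) (use P R f0 g0 \<open>coeff R ?d \<noteq> 0\<close> in \<open>auto simp: c_def intro: degree_diff_le order.trans[OF degree_smult_le]\<close>)
  then have vanish: "f (\<lambda>i. (1, z ^ q ^ i)) - c * g (\<lambda>i. (1, z ^ q ^ i)) = 0" for z
    unfolding P(2)[symmetric] R(2)[symmetric] by (metis poly_0 poly_diff poly_smult)
  obtain Q where Q: "degree Q \<le> ?d" "\<And>z. poly Q z = f (\<lambda>i. (1, z ^ q ^ i)) - c * g (\<lambda>i. (1, z ^ q ^ i))"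
      "Q = 0 \<Longrightarrow> \<forall>w. f w - c * g w = 0"
    using multilinear_polynomial[OF q multilinear_on_diff[OF f multilinear_on_scale[OF g, of c]]] by metis
  have "Q = 0"
  proof (rule ccontr)
    assume "Q \<noteq> 0"
    from card_poly_roots_bound[OF this] show False using Q(1) big by (simp add: Q(2) vanish)
  qed
  then show ?thesis using Q(3) by (intro exI[of _ c]) simp
qed

section \<open>Products of 2 by 2 matrices\<close>

datatype 'a mat2 = Mat2 (e11: 'a) (e12: 'a) (e21: 'a) (e22: 'a)

fun mat2_mult :: "'a::comm_ring mat2 \<Rightarrow> 'a mat2 \<Rightarrow> 'a mat2" where
  "mat2_mult (Mat2 a b c d) (Mat2 a' b' c' d') =
    Mat2 (a * a' + b * c') (a * b' + b * d') (c * a' + d * c') (c * b' + d * d')"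

fun mat2_det :: "'a::comm_ring mat2 \<Rightarrow> 'a" where
  "mat2_det (Mat2 a b c d) = a * d - b * c"

fun mat2_prod :: "(nat \<Rightarrow> 'a::comm_ring_1 mat2) \<Rightarrow> nat \<Rightarrow> 'a mat2" where
  "mat2_prod M 0 = Mat2 1 0 0 1"
| "mat2_prod M (Suc n) = mat2_mult (M n) (mat2_prod M n)"

fun mat2_scale :: "'a::comm_ring \<Rightarrow> 'a mat2 \<Rightarrow> 'a mat2" where
  "mat2_scale c (Mat2 a b c' d) = Mat2 (c * a) (c * b) (c * c') (c * d)"

lemma mat2_mult_sel:
  "e11 (mat2_mult A B) = e11 A * e11 B + e12 A * e21 B"
  "e12 (mat2_mult A B) = e11 A * e12 B + e12 A * e22 B"
  "e21 (mat2_mult A B) = e21 A * e11 B + e22 A * e21 B"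
  "e22 (mat2_mult A B) = e21 A * e12 B + e22 A * e22 B"
  by (cases A; cases B; simp)+

lemma mat2_det_mult: "mat2_det (mat2_mult A B) = mat2_det A * mat2_det B"
  by (cases A; cases B; simp add: algebra_simps)

lemma mat2_det_prod: "mat2_det (mat2_prod M n) = (\<Prod>i<n. mat2_det (M i))"
  by (induction n) (simp_all add: mat2_det_mult mult.commute)

lemma mat2_prod_cong: "(\<And>i. i < n \<Longrightarrow> M i = N i) \<Longrightarrow> mat2_prod M n = mat2_prod N n"
  by (induction n) auto

text \<open>
  Applied to sequences that close up, possibly after a change of sign, this produces eigenvectors of
  the product without dividing by the multipliers \<open>s p\<close>.
\<close>
lemma mat2_prod_chain:
  assumes "\<And>p. p < n \<Longrightarrow> e11 (M p) * x p + e12 (M p) * y p = s p * x (Suc p)"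
    and "\<And>p. p < n \<Longrightarrow> e21 (M p) * x p + e22 (M p) * y p = s p * y (Suc p)"
  shows "e11 (mat2_prod M n) * x 0 + e12 (mat2_prod M n) * y 0 = (\<Prod>p<n. s p) * x n \<and>
    e21 (mat2_prod M n) * x 0 + e22 (mat2_prod M n) * y 0 = (\<Prod>p<n. s p) * y n"
  using assms
proof (induction n)
  case (Suc n)
  define R where "R = mat2_prod M n"
  have IH: "e11 R * x 0 + e12 R * y 0 = (\<Prod>p<n. s p) * x n" "e21 R * x 0 + e22 R * y 0 = (\<Prod>p<n. s p) * y n"
    using Suc by (simp_all add: R_def)
  have st: "e11 (M n) * x n + e12 (M n) * y n = s n * x (Suc n)"
    "e21 (M n) * x n + e22 (M n) * y n = s n * y (Suc n)" using Suc.prems by simp_all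
  have comp: "(a * e11 R + b * e21 R) * x 0 + (a * e12 R + b * e22 R) * y 0 =
    (\<Prod>p<n. s p) * (a * x n + b * y n)" for a b
  proof -
    have "(a * e11 R + b * e21 R) * x 0 + (a * e12 R + b * e22 R) * y 0 =
      a * (e11 R * x 0 + e12 R * y 0) + b * (e21 R * x 0 + e22 R * y 0)" by (simp add: algebra_simps)
    then show ?thesis unfolding IH by (simp add: algebra_simps)
  qed
  show ?case unfolding mat2_prod.simps mat2_mult_sel R_def[symmetric] prod.lessThan_Suc comp st
    by (simp add: mult.assoc)
qed simp


definition multilinear_mat :: "nat set \<Rightarrow> ((nat \<Rightarrow> 'a \<times> 'a) \<Rightarrow> 'a::field mat2) \<Rightarrow> bool" where
  "multilinear_mat S M \<longleftrightarrow> multilinear_on S (\<lambda>w. e11 (M w)) \<and> multilinear_on S (\<lambda>w. e12 (M w)) \<and>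
    multilinear_on S (\<lambda>w. e21 (M w)) \<and> multilinear_on S (\<lambda>w. e22 (M w))"

lemma multilinear_mat_mult:
  assumes "multilinear_mat S M" "multilinear_mat T N" "S \<inter> T = {}"
  shows "multilinear_mat (S \<union> T) (\<lambda>w. mat2_mult (M w) (N w))"
  using assms unfolding multilinear_mat_def mat2_mult_sel
  by (intro conjI multilinear_on_add multilinear_on_mult) simp_all

lemma multilinear_mat_prod:
  assumes "\<And>p. p < n \<Longrightarrow> multilinear_mat (S p) (\<lambda>w. M w p)" "disjoint_family_on S {..<n}"
  shows "multilinear_mat (\<Union>p<n. S p) (\<lambda>w. mat2_prod (M w) n)"
  using assms
proof (induction n)
  case (Suc n)
  have "multilinear_mat (\<Union>p<n. S p) (\<lambda>w. mat2_prod (M w) n)"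
    using Suc by (intro Suc.IH) (auto intro: disjoint_family_on_mono[rotated])
  moreover have "S n \<inter> S p = {}" if "p < n" for p
    using that by (intro disjoint_family_onD[OF Suc.prems(2)]) auto
  then have "S n \<inter> (\<Union>p<n. S p) = {}" by blast
  ultimately have "multilinear_mat (S n \<union> (\<Union>p<n. S p)) (\<lambda>w. mat2_prod (M w) (Suc n))"
    unfolding mat2_prod.simps using Suc.prems(1)[of n] by (intro multilinear_mat_mult) auto
  moreover have "(\<Union>p<Suc n. S p) = S n \<union> (\<Union>p<n. S p)" by (simp add: lessThan_Suc)
  ultimately show ?case by simp
qed (simp add: multilinear_mat_def multilinear_on_def)

lemma multilinear_on_prod:
  fixes n :: nat
  assumes "\<And>p. p < n \<Longrightarrow> multilinear_on (S p) (f p)" "disjoint_family_on S {..<n}"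
  shows "multilinear_on (\<Union>p<n. S p) (\<lambda>w. \<Prod>p<n. f p w)"
  using assms
proof (induction n)
  case (Suc n)
  have "multilinear_on (\<Union>p<n. S p) (\<lambda>w. \<Prod>p<n. f p w)"
    using Suc by (intro Suc.IH) (auto intro: disjoint_family_on_mono[rotated])
  moreover have "S p \<inter> S n = {}" if "p < n" for p
    using that by (intro disjoint_family_onD[OF Suc.prems(2)]) auto
  then have "(\<Union>p<n. S p) \<inter> S n = {}" by blast
  ultimately have "multilinear_on ((\<Union>p<n. S p) \<union> S n) (\<lambda>w. (\<Prod>p<n. f p w) * f n w)"
    using Suc.prems(1)[of n] by (intro multilinear_on_mult) auto
  moreover have "(\<Union>p<Suc n. S p) = (\<Union>p<n. S p) \<union> S n" by (auto simp: lessThan_Suc)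
  ultimately show ?case by simp
qed (simp add: multilinear_on_def)

section \<open>The form of \<open>\<psi>\<close>\<close>

text \<open>
  For $u = x_i$, $v = \psi(x)_i$, $u' = x_{i+5}$ and $v' = \psi(x)_{i+5}$, this matrix
  maps $(a_{i-1}, b_i)$ to a multiple of $(a_i, b_{i+1})$. The determinant is the square of \<open>(v u' + u v') / 2\<close>.
\<close>
definition psi_transfer :: "'a::field \<times> 'a \<Rightarrow> 'a \<times> 'a \<Rightarrow> 'a mat2" where
  "psi_transfer x y = Mat2 (fst x * fst y) (- ((snd x * fst y - fst x * snd y) / 2))
     ((snd x * fst y - fst x * snd y) / 2) (snd x * snd y)"

text \<open>
  After five steps $(a_{-1}, b_0)$ has become a multiple of $(a_4, b_5) = (a_{-1}, - b_0)$. The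
  difference of the diagonal entries, rather than their sum, measures whether this is possible.
\<close>
definition psi_form :: "(nat \<Rightarrow> 'a::field \<times> 'a) \<Rightarrow> 'a" where
  "psi_form w = (let R = mat2_prod (\<lambda>i. psi_transfer (w i) (w (i + 5))) 5 in e11 R - e22 R)"

lemma multilinear_on_pair:
  assumes "multilinear_on {i} f" "multilinear_on {j} g" "i \<noteq> j"
  shows "multilinear_on {i, j} (\<lambda>w. f w * g w)"
  using multilinear_on_mult[OF assms(1,2)] assms(3) by (simp add: insert_commute)

lemma multilinear_psi_form: "multilinear_on {..<10} (psi_form :: _ \<Rightarrow> 'a::field)"
proof -
  have pair: "multilinear_mat {p, p + 5} (\<lambda>w. psi_transfer (w p) (w (p + 5)) :: 'a mat2)" for p
  proof -
    have d: "multilinear_on {p, p + 5} (\<lambda>w. c * (snd (w p) * fst (w (p + 5)) - fst (w p) * snd (w (p + 5))))" for c :: 'a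
      by (intro multilinear_on_scale multilinear_on_diff multilinear_on_pair multilinear_on_fst multilinear_on_snd) simp_all
    show ?thesis using d[of "1/2"] d[of "-1/2"]
      by (simp add: multilinear_mat_def psi_transfer_def multilinear_on_pair multilinear_on_fst multilinear_on_snd)
  qed
  have "multilinear_mat (\<Union>p<5. {p, p + 5}) (\<lambda>w. mat2_prod (\<lambda>i. psi_transfer (w i) (w (i + 5)) :: 'a mat2) 5)"
    by (rule multilinear_mat_prod[OF pair]) (auto simp: disjoint_family_on_def)
  moreover have "(\<Union>p<5. {p, p + 5}) = {..<10::nat}" by (auto simp: eval_nat_numeral less_Suc_eq)
  ultimately show ?thesis unfolding psi_form_def Let_def multilinear_mat_def
    by (intro multilinear_on_diff) simp_all
qed

text \<open>
  After composition with the reflection \<open>(x, y) \<mapsto> (x, - y)\<close> the matrix \<open>R\<close> has the eigenvalue \<open>t\<close> and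
  the determinant \<open>- t * t\<close>, so the other eigenvalue is \<open>- t\<close> and the trace of the composition is zero.
\<close>
lemma eigenvector_trace:
  assumes "e11 R * x + e12 R * y = t * x" "e21 R * x + e22 R * y = - (t * y)"
    "mat2_det R = t * t" "t \<noteq> 0" "x \<noteq> 0 \<or> y \<noteq> (0::'a::field)"
  shows "e11 R = e22 R"
proof -
  obtain a b c d where R: "R = Mat2 a b c d" by (cases R)
  have "t * (a - d) * x = 0" "t * (a - d) * y = 0"
    using assms(1-3) unfolding R by (simp_all, algebra, algebra)
  then show ?thesis using assms(4,5) R by auto
qed

lemma psi_form_unfold:
  fixes w :: "nat \<Rightarrow> 'a::field \<times> 'a"
  defines "T \<equiv> \<lambda>i. psi_transfer (w i) (w (i + 5))"
  defines "R \<equiv> \<lambda>M. mat2_mult (T 4) (mat2_mult (T 3) (mat2_mult (T 2) (mat2_mult (T 1) M)))"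
  shows "psi_form (w(0 := x, 5 := y)) = e11 (R (psi_transfer x y)) - e22 (R (psi_transfer x y))"
proof -
  have "mat2_mult (psi_transfer x y) (Mat2 1 0 0 1) = psi_transfer x y" by (cases "psi_transfer x y") simp
  then show ?thesis by (simp add: psi_form_def R_def T_def eval_nat_numeral Let_def)
qed

text \<open>
  The entries of \<open>psi_transfer x y\<close> depend on the mixed products \<open>u v'\<close> and \<open>v u'\<close> only through their
  difference. This is the linear condition satisfied by all bilinear forms in the arguments 0 and 5.
\<close>
lemma psi_form_antisymmetric:
  "psi_form (w(0 := (1, 0), 5 := (0, 1))) + psi_form (w(0 := (0, 1), 5 := (1, 0))) = (0::'a::field)"
proof -
  have scale: "mat2_mult A (mat2_scale c B) = mat2_scale c (mat2_mult A B)" for A B :: "'a mat2" and c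
    by (cases A; cases B) (simp add: algebra_simps)
  have sel: "e11 (mat2_scale c A) = c * e11 A" "e22 (mat2_scale c A) = c * e22 A" for A :: "'a mat2" and c
    by (cases A; simp)+
  have "psi_transfer (0, 1) (1, 0) = mat2_scale (-1) (psi_transfer (1, 0) (0, 1 :: 'a))"
    by (simp add: psi_transfer_def)
  then show ?thesis unfolding psi_form_unfold by (simp only: scale sel) simp
qed

text \<open>
  Conversely the three bilinear forms $u u'$, $v v'$ and $v u' - u v'$ all occur.
\<close>
lemma psi_form_values:
  fixes x y :: "'a::field \<times> 'a"
  shows "psi_form ((\<lambda>_. (1, 0))(0 := x, 5 := y)) = fst x * fst y"
    and "psi_form ((\<lambda>_. (0, 1))(0 := x, 5 := y)) = - (snd x * snd y)"
    and "psi_form ((\<lambda>i. if i \<in> {3, 4, 9} then (1, 0) else (0, 1))(0 := x, 5 := y)) =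
      1 / 2 * ((snd x * fst y - fst x * snd y) / 2)"
proof -
  obtain a b c d where T: "psi_transfer x y = Mat2 a b c d" by (cases "psi_transfer x y")
  have abcd: "a = fst x * fst y" "c = (snd x * fst y - fst x * snd y) / 2" "d = snd x * snd y"
    using T by (simp_all add: psi_transfer_def)
  have tab: "psi_transfer (1, 0) (1, 0) = Mat2 1 0 0 (0::'a)" "psi_transfer (0, 1) (0, 1) = Mat2 0 0 0 (1::'a)"
    "psi_transfer (1, 0) (0, 1) = Mat2 0 (1/2) (-(1/2)) (0::'a)"
    by (simp_all add: psi_transfer_def)
  show "psi_form ((\<lambda>_. (1, 0))(0 := x, 5 := y)) = fst x * fst y"
    and "psi_form ((\<lambda>_. (0, 1))(0 := x, 5 := y)) = - (snd x * snd y)"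
    and "psi_form ((\<lambda>i. if i \<in> {3, 4, 9} then (1, 0) else (0, 1))(0 := x, 5 := y)) =
      1 / 2 * ((snd x * fst y - fst x * snd y) / 2)"
    unfolding psi_form_unfold T abcd[symmetric] by (simp_all add: tab)
qed

section \<open>The form of \<open>\<delta> x ^ (q ^ s) + x ^ (q ^ (10 - s))\<close>\<close>

text \<open>
  The recursion is $z_i y_i = \delta_i y_{i+s} + y_{i-s}$. For a multiple \<open>x\<close> of $(1, z_i)$ and
  $d = \delta_i$ this matrix maps $(y_i, y_{i-s})$ to a multiple of $(y_{i+s}, y_i)$; having \<open>d\<close> in the
  second row avoids a division by \<open>d\<close>.
\<close>
definition lp_transfer :: "'a::field \<Rightarrow> 'a \<times> 'a \<Rightarrow> 'a mat2" where
  "lp_transfer d x = Mat2 (snd x) (- fst x) (d * fst x) 0"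

text \<open>
  The position \<open>p\<close> stands for the Frobenius exponent \<open>s * p\<close>. If \<open>U\<close> is the product of the first
  components and \<open>N\<close> that of the \<open>d p\<close>, the matrix product has determinant \<open>N * U * U\<close> and must have the
  eigenvalue \<open>N * U\<close>, so that its trace is \<open>(1 + N) * U\<close>.
\<close>
definition lp_form :: "(nat \<Rightarrow> 'a::field) \<Rightarrow> (nat \<Rightarrow> 'a \<times> 'a) \<Rightarrow> 'a" where
  "lp_form d c = (let R = mat2_prod (\<lambda>p. lp_transfer (d p) (c p)) 10 in
    e11 R + e22 R - (1 + (\<Prod>p<10. d p)) * (\<Prod>p<10. fst (c p)))"

text \<open>
  At the positions other than 0 and 5, the vector \<open>(0, 1)\<close> turns the transfer matrix into the
  projection to the first coordinate. One vector \<open>(1, 0)\<close> next to position 0, and one next to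
  position 5, select the other entries of the two remaining matrices.
\<close>
lemma lp_form_values:
  fixes x y :: "'a::field \<times> 'a"
  shows "lp_form d ((\<lambda>p. if p = 1 then (1, 0) else (0, 1))(0 := x, 5 := y)) = - d 0 * (fst x * snd y)"
    and "lp_form d ((\<lambda>p. if p = 1 \<or> p = 6 then (1, 0) else (0, 1))(0 := x, 5 := y)) = d 0 * d 5 * (fst x * fst y)"
  by (simp_all add: lp_form_def lp_transfer_def eval_nat_numeral Let_def)

lemma lp_form_zero:
  assumes "d = (\<lambda>_. 0)"
  shows "lp_form d c = (\<Prod>p<10. snd (c p)) - (\<Prod>p<10. fst (c p))"
proof -
  have "e11 (mat2_prod (\<lambda>p. lp_transfer (d p) (c p)) n) = (\<Prod>p<n. snd (c p)) \<and>
    (n > 0 \<longrightarrow> e22 (mat2_prod (\<lambda>p. lp_transfer (d p) (c p)) n) = 0) \<and>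
    e21 (mat2_prod (\<lambda>p. lp_transfer (d p) (c p)) n) = 0" for n
    by (induction n) (simp_all add: mat2_mult_sel lp_transfer_def assms mult.commute)
  from this[of 10] show ?thesis by (simp add: lp_form_def Let_def assms)
qed

lemma multilinear_lp_form:
  assumes "inj_on idx {..<10}" "idx ` {..<10} = {..<10}"
  shows "multilinear_on {..<10} (\<lambda>w. lp_form d (\<lambda>p. w (idx p)))"
proof -
  have disj: "disjoint_family_on (\<lambda>p. {idx p}) {..<10}"
    using assms(1) by (auto simp: disjoint_family_on_def inj_on_def)
  have U: "(\<Union>p<10. {idx p}) = {..<10}" using assms(2) by auto
  have "multilinear_on {i} (\<lambda>w. c * fst (w i))" for i :: nat and c :: 'a
    by (intro multilinear_on_scale multilinear_on_fst)
  note scaled = this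
  have "multilinear_mat {i} (\<lambda>w. lp_transfer c (w i))" for i :: nat and c :: 'a
    using scaled[of i c] scaled[of i "-1"]
    by (simp add: multilinear_mat_def lp_transfer_def multilinear_on_snd multilinear_on_zero)
  then have "multilinear_mat (\<Union>p<10. {idx p}) (\<lambda>w. mat2_prod (\<lambda>p. lp_transfer (d p) (w (idx p))) 10)"
    by (intro multilinear_mat_prod disj)
  moreover have "multilinear_on (\<Union>p<10. {idx p}) (\<lambda>w. \<Prod>p<10. fst (w (idx p)) :: 'a)"
    by (intro multilinear_on_prod disj multilinear_on_fst)
  ultimately show ?thesis unfolding lp_form_def Let_def multilinear_mat_def U
    by (intro multilinear_on_diff multilinear_on_add multilinear_on_scale) simp_all
qed

lemma lp_form_vanishes:
  assumes y: "y 0 \<noteq> 0" "y 10 = y 0" "z 0 = y 9" "\<And>p. p < 9 \<Longrightarrow> z (Suc p) = y p"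
    and m: "\<And>p. p < 10 \<Longrightarrow> m p * y p \<noteq> (0::'a::field)"
    and d: "(\<Prod>p<10. d p) \<noteq> 0"
    and c: "\<And>p. p < 10 \<Longrightarrow> c p = (m p * y p, m p * (d p * y (Suc p) + z p))"
  shows "lp_form d c = 0"
proof -
  define R where "R = mat2_prod (\<lambda>p. lp_transfer (d p) (c p)) 10"
  \<comment> \<open>\<open>z\<close> extended by one index, so that \<open>y\<close> and \<open>z'\<close> close up after ten steps\<close>
  define z' where "z' p = (if p = 10 then y 9 else z p)" for p
  define N U where "N = (\<Prod>p<10. d p)" and "U = (\<Prod>p<10. fst (c p))"
  have z': "z' (Suc p) = y p" if "p < 10" for p
    using that y(4)[of p] by (auto simp: z'_def less_Suc_eq eval_nat_numeral)
  have "e11 R * y 0 + e12 R * z' 0 = (\<Prod>p<10. d p * fst (c p)) * y 10 \<and>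
    e21 R * y 0 + e22 R * z' 0 = (\<Prod>p<10. d p * fst (c p)) * z' 10"
    unfolding R_def
  proof (rule mat2_prod_chain)
    fix p :: nat assume p: "p < 10"
    show "e11 (lp_transfer (d p) (c p)) * y p + e12 (lp_transfer (d p) (c p)) * z' p =
        d p * fst (c p) * y (Suc p)"
      using p by (simp add: lp_transfer_def c z'_def algebra_simps)
    show "e21 (lp_transfer (d p) (c p)) * y p + e22 (lp_transfer (d p) (c p)) * z' p =
        d p * fst (c p) * z' (Suc p)"
      using p by (simp add: lp_transfer_def z')
  qed
  then have R1: "e11 R * y 0 + e12 R * y 9 = N * U * y 0" "e21 R * y 0 + e22 R * y 9 = N * U * y 9"
    using y(2,3) by (simp_all add: z'_def N_def U_def prod.distrib)
  have "mat2_det R = (\<Prod>p<10. d p * (fst (c p) * fst (c p)))"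
    unfolding R_def mat2_det_prod by (simp add: lp_transfer_def mult_ac)
  then have R2: "mat2_det R = N * (U * U)" unfolding N_def U_def by (simp only: prod.distrib)
  have "U \<noteq> 0" unfolding U_def using m c by simp
  obtain r s t u where R: "R = Mat2 r s t u" by (cases R)
  have "(r - N * U) * (u - N * U) - s * t = 0"
    using R1 y(1) unfolding R by (simp, algebra)
  then have "N * U * (r + u - (1 + N) * U) = 0" using R2 unfolding R by (simp, algebra)
  then show ?thesis using \<open>U \<noteq> 0\<close> d unfolding lp_form_def R_def[symmetric] N_def[symmetric] U_def[symmetric] Let_def
    by (simp add: R)
qed

text \<open>
  For zero coefficients the eigenvalue argument degenerates, but the sequence \<open>z\<close> is then a cyclic
  shift of \<open>y\<close> and the two products agree.
\<close>
lemma lp_form_zero_vanishes: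
  fixes y z m :: "nat \<Rightarrow> 'a::field"
  assumes "z 0 = y 9" "\<And>p. p < 9 \<Longrightarrow> z (Suc p) = y p"
    and c: "\<And>p. p < 10 \<Longrightarrow> c p = (m p * y p, m p * z p)"
  shows "lp_form (\<lambda>_. 0) c = 0"
proof -
  have "(\<Prod>p<Suc 9. z p) = y 9 * (\<Prod>p<9. y p)"
    unfolding prod.lessThan_Suc_shift assms(1) by (intro arg_cong2[where f = "(*)"] prod.cong) (simp_all add: assms(2))
  also have "\<dots> = (\<Prod>p<Suc 9. y p)" unfolding prod.lessThan_Suc by (rule mult.commute)
  finally have "(\<Prod>p<10. z p) = (\<Prod>p<10. y p)" by (simp del: prod.lessThan_Suc)
  then show ?thesis unfolding lp_form_zero[OF refl] by (simp add: c prod.distrib)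
qed

lemma lp_form_cong:
  "(\<And>p. p < 10 \<Longrightarrow> c p = c' p) \<Longrightarrow> lp_form d c = lp_form d c'"
  unfolding lp_form_def
  using mat2_prod_cong[of 10 "\<lambda>p. lp_transfer (d p) (c p)" "\<lambda>p. lp_transfer (d p) (c' p)"] by simp

section \<open>Frobenius maps and the components of \<open>\<psi>\<close>\<close>

locale degree_ten =
  fixes q :: nat and ty :: "'a::{field,finite} itself"
  assumes primepow_q: "primepow q" and q_mod_4: "q mod 4 = 1"
    and card_field: "CARD('a) = q ^ 10"
begin

text \<open>
  The powers of the Frobenius map over the field of order \<open>q\<close>: \<open>F i x\<close> is $x_i$.
\<close>
definition F :: "nat \<Rightarrow> 'a \<Rightarrow> 'a" where "F k x = x ^ (q ^ k)"

lemma q_ge_5: "q \<ge> 5"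
proof -
  have "q > 1" using primepow_q by (rule primepow_gt_Suc_0[unfolded One_nat_def[symmetric]])
  then show ?thesis using q_mod_4 by presburger
qed

lemma F_char: "prime CHAR('a)" "\<exists>k. q = CHAR('a) ^ k"
proof -
  show pr: "prime CHAR('a)" by (rule prime_CHAR_semidom, rule finite_imp_CHAR_pos, simp)
  obtain p k where pk: "prime p" "q = p ^ k" using primepow_q unfolding primepow_def by blast
  have "CHAR('a) dvd q ^ 10" 
    using of_nat_card_eq_0[where ?'a='a] unfolding of_nat_eq_0_iff_char_dvd card_field .
  then have "CHAR('a) dvd p" using pr pk by (metis prime_dvd_power)
  then have "CHAR('a) = p" using pr pk by (metis primes_dvd_imp_eq)
  then show "\<exists>k. q = CHAR('a) ^ k" using pk by blast
qed

lemma two_neq_0: "(2::'a) \<noteq> 0"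
proof
  assume "(2::'a) = 0"
  then have "of_nat 2 = (0::'a)" by simp
  then have "CHAR('a) dvd 2" by (simp only: of_nat_eq_0_iff_char_dvd)
  then have "CHAR('a) = 2" using F_char(1) by (metis two_is_prime_nat primes_dvd_imp_eq)
  then obtain k where "q = 2 ^ k" using F_char(2) by metis
  moreover have "odd q" using q_mod_4 by presburger
  ultimately have "q = 1" by (cases k) auto
  then show False using q_ge_5 by simp
qed

lemma F_add: "F k (x + y) = F k x + F k y"
proof -
  obtain m where "q = CHAR('a) ^ m" using F_char(2) by blast
  then have "q ^ k = CHAR('a) ^ (m * k)" by (simp add: power_mult)
  then show ?thesis unfolding F_def by (rule freshmans_dream'[OF F_char(1)])
qed

lemma F_0 [simp]: "F k 0 = 0" using q_ge_5 by (simp add: F_def)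
lemma F_1 [simp]: "F k 1 = 1" by (simp add: F_def)
lemma F_mult: "F k (x * y) = F k x * F k y" by (simp add: F_def power_mult_distrib)
lemma F_divide: "F k (x / y) = F k x / F k y" by (simp add: F_def power_divide)
lemma F_minus: "F k (- x) = - F k x"
  using F_add[of k x "-x"] by (simp add: add_eq_0_iff)
lemma F_diff: "F k (x - y) = F k x - F k y"
  using F_add[of k x "-y"] by (simp add: F_minus)
lemma F_2 [simp]: "F k 2 = 2"
  using F_add[of k 1 1] by simp
lemma F_eq_0_iff [simp]: "F k x = 0 \<longleftrightarrow> x = 0" using q_ge_5 by (simp add: F_def)
lemma F_sum: "F k (sum f S) = (\<Sum>i\<in>S. F k (f i))"
  by (induction S rule: infinite_finite_induct) (auto simp: F_add)
lemma F_F: "F j (F k x) = F (j + k) x"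
  by (simp add: F_def flip: power_mult power_add) (simp add: add.commute)
lemma F_zero: "F 0 x = x" by (simp add: F_def)
lemma F_add_10: "F (k + 10) x = F k x"
  using power_card_eq_self[of x] by (simp add: card_field F_def power_add power_mult mult.commute[of "q^k"])
lemma F_mod: "F (k mod 10) x = F k x"
proof -
  have "F (k + 10 * m) x = F k x" for k m
    by (induction m) (use F_add_10[of "k + 10 * _" x] in \<open>auto simp: add_ac\<close>)
  from this[of "k mod 10" "k div 10"] show ?thesis by simp
qed

lemmas F_ring = F_add F_diff F_minus F_mult F_divide F_F

text \<open>
  The exponent \<open>q - 1\<close> is a multiple of 4, and the fourth power of a square root of \<open>- 1\<close> is 1.
\<close>
lemma F1_sqrt_minus_1: assumes "r * r = - 1" shows "F 1 r = r"
proof -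
  obtain m where m: "q = 4 * m + 1" using q_mod_4 by (metis mult_div_mod_eq)
  have "r ^ 4 = (r * r) * (r * r)" by (simp add: power4_eq_xxxx)
  then have "r ^ q = r" unfolding m power_add power_mult assms by simp
  then show ?thesis by (simp add: F_def)
qed

lemma eigen_unique:
  assumes "F 5 e = e" "F 5 e' = e'" "F 5 w = - w" "F 5 w' = - w'" "e + w = e' + w'"
  shows "e = e'" "w = w'"
proof -
  have "e - w = e' - w'" using arg_cong[OF assms(5), of "F 5"] unfolding F_add assms(1-4) by simp
  then have "2 * e = 2 * e'" using assms(5) by algebra
  then show "e = e'" using two_neq_0 by simp
  then show "w = w'" using assms(5) by simp
qed

definition half_plus :: "'a \<Rightarrow> 'a" where "half_plus x = (x + F 5 x) / 2"
definition half_minus :: "'a \<Rightarrow> 'a" where "half_minus x = (x - F 5 x) / 2"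

lemma F5_half: "F 5 (half_plus x) = half_plus x" "F 5 (half_minus x) = - half_minus x"
  using F_add_10[of 0 x] two_neq_0
  by (simp_all add: half_plus_def half_minus_def F_ring F_zero field_simps)

lemma half_sum: "half_plus x + half_minus x = x"
  using two_neq_0 by (simp add: half_plus_def half_minus_def field_simps)

definition psi :: "'a \<Rightarrow> 'a" where "psi x = (F 1 x + F 4 x - F 6 x + F 9 x) / 2"

lemma psi_half: "psi x = F 9 (half_plus x) + F 1 (half_minus x)"
proof -
  have "F 9 (half_plus x) = (F 9 x + F 4 x) / 2" "F 1 (half_minus x) = (F 1 x - F 6 x) / 2"
    using F_add_10[of 4 x] by (simp_all add: half_plus_def half_minus_def F_ring)
  then show ?thesis
    by (simp only: psi_def flip: add_divide_distrib) (simp add: algebra_simps)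
qed

lemma poly_psi10: "poly (psi10 q) x = psi x"
  by (simp add: psi10_def psi_def F_def poly_monom)

lemma psi_add: "psi (x + y) = psi x + psi y"
  by (simp add: psi_def F_ring add_divide_distrib diff_divide_distrib)

lemma F_fixed: assumes "F 1 c = c" shows "F k c = c"
proof (induction k)
  case (Suc k) then show ?case using F_F[of 1 k c] assms by simp
qed (simp add: F_zero)

lemma psi_scale: "F 1 c = c \<Longrightarrow> psi (c * x) = c * psi x"
  by (simp add: psi_def F_mult F_fixed algebra_simps)

lemma F1_F9: "F (Suc 0) (F 9 x) = x" "F 1 (F 9 x) = x" using F_F[of 1 9 x] F_add_10[of 0 x] by (simp_all add: F_zero)

text \<open>
  Taking the product of the first five Frobenius conjugates of \<open>a * F 9 a = b * F 1 b\<close> gives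
  \<open>N a * N a = - (N b * N b)\<close>, the sign coming from \<open>F 5 b = - b\<close>. The quotient \<open>N a / N b\<close> changes its
  sign under \<open>F 1\<close> for the same reason, but as a square root of \<open>- 1\<close> it must be fixed.
\<close>
lemma norm_form_neq_0:
  assumes a: "F 5 a = a" and b: "F 5 b = - b" and nz: "a \<noteq> 0 \<or> b \<noteq> 0"
  shows "a * F 9 a \<noteq> b * F 1 b"
proof
  assume eq: "a * F 9 a = b * F 1 b"
  have ne: "a \<noteq> 0" "b \<noteq> 0" using eq nz by auto
  have a9: "F 9 a = F 4 a" using F_F[of 4 5 a] a by simp
  define N where "N x = x * F 1 x * F 2 x * F 3 x * F 4 x" for x
  have eqk: "F k a * F (k + 4) a = F k b * F (k + 1) b" for k
    using arg_cong[OF eq, of "F k"] by (simp add: a9 F_ring)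
  have a5: "F 5 a = a" "F 6 a = F 1 a" "F 7 a = F 2 a" "F 8 a = F 3 a"
    using F_F[of 1 5 a] F_F[of 2 5 a] F_F[of 3 5 a] by (simp_all add: a)
  have nums: "0 + 4 = (4::nat)" "0 + 1 = (1::nat)" "1 + 4 = (5::nat)" "1 + 1 = (2::nat)" "2 + 4 = (6::nat)"
      "2 + 1 = (3::nat)" "3 + 4 = (7::nat)" "3 + 1 = (4::nat)" "4 + 4 = (8::nat)" "4 + 1 = (5::nat)"
      "1 + 2 = (3::nat)" "1 + 3 = (4::nat)" by simp_all
  have e: "a * F 4 a = b * F 1 b" "F 1 a * a = F 1 b * F 2 b" "F 2 a * F 1 a = F 2 b * F 3 b"
      "F 3 a * F 2 a = F 3 b * F 4 b" "F 4 a * F 3 a = F 4 b * - b"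
    using eqk[of 0] eqk[of 1] eqk[of 2] eqk[of 3] eqk[of 4]
    by (simp_all only: nums a5 b F_zero)
  have "N a * N a = (a * F 4 a) * (F 1 a * a) * (F 2 a * F 1 a) * (F 3 a * F 2 a) * (F 4 a * F 3 a)"
    by (simp add: N_def)
  also have "\<dots> = - (N b * N b)"
    unfolding e by (simp add: N_def)
  finally have "N a * N a = - (N b * N b)" .
  moreover have "N b \<noteq> 0" using ne by (simp add: N_def)
  ultimately have r: "(N a / N b) * (N a / N b) = - 1" by (simp add: field_simps)
  have "F 1 (N a) = N a" "F 1 (N b) = - N b"
    by (simp_all only: N_def F_mult F_F nums a b) (simp_all only: mult_ac mult_minus_left mult_minus_right)
  then have "F 1 (N a / N b) = - (N a / N b)" by (simp add: F_divide)
  with F1_sqrt_minus_1[OF r] have "2 * (N a / N b) = 0" by (metis add.right_inverse mult_2)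
  then show False using r two_neq_0 by auto
qed

text \<open>
  The two eigencomponents of the equation, the first of them raised to the power \<open>q\<close>, have the
  common unknown \<open>F 1 u - u\<close>. Eliminating it shows that \<open>v * s\<close> is fixed by \<open>F 1\<close>, where \<open>s\<close> is the
  quantity of \<open>norm_form_neq_0\<close>. As \<open>v * s\<close> is also anti-invariant under \<open>F 5\<close>, it is zero.
\<close>
lemma scattered:
  assumes x: "x \<noteq> 0" and eq: "psi (l * x) = l * psi x"
  shows "F 1 l = l"
proof -
  define a b u v where "a = half_plus x" and "b = half_minus x" and "u = half_plus l" and "v = half_minus l"
  have ab: "F 5 a = a" "F 5 b = - b" and uv: "F 5 u = u" "F 5 v = - v" by (simp_all add: a_def b_def u_def v_def F5_half)
  have x': "x = a + b" and l': "l = u + v" by (simp_all add: a_def b_def u_def v_def half_sum)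
  have comm: "F 5 (F k y) = F k (F 5 y)" for k y by (simp add: F_F add.commute)
  have eig: "F 5 (u * a + v * b) = u * a + v * b" "F 5 (u * b + v * a) = - (u * b + v * a)"
    by (simp_all add: F_ring ab uv)
  have sum: "half_plus (l * x) + half_minus (l * x) = (u * a + v * b) + (u * b + v * a)"
    unfolding half_sum x' l' by algebra
  note lx = eigen_unique[OF F5_half(1) eig(1) F5_half(2) eig(2) sum]
  have "F 9 (u * a + v * b) + F 1 (u * b + v * a) = (u + v) * (F 9 a + F 1 b)"
    using eq unfolding psi_half[of "l * x"] psi_half[of x] lx by (simp add: l' flip: a_def b_def)
  then have e: "F 9 (u * a + v * b) + F 1 (u * b + v * a) = (u * F 9 a + v * F 1 b) + (u * F 1 b + v * F 9 a)"
    by (simp add: algebra_simps)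
  note eqs = eigen_unique[OF _ _ _ _ e]
  have e1: "F 9 (u * a + v * b) = u * F 9 a + v * F 1 b"
    by (rule eqs) (simp_all add: F_add F_mult F_minus comm ab uv)
  have e2: "F 1 (u * b + v * a) = u * F 1 b + v * F 9 a"
    by (rule eqs) (simp_all add: F_add F_mult F_minus comm ab uv)
  have e1': "u * a + v * b = F 1 u * a + F 1 v * F 1 (F 1 b)"
    using arg_cong[OF e1, of "F 1"] by (simp only: F_mult F_add F1_F9)
  have e2': "F 1 u * F 1 b + F 1 v * F 1 a = u * F 1 b + v * F 9 a"
    using e2 by (simp only: F_mult F_add)
  define s where "s = a * F 9 a - b * F 1 b"
  have F1s: "F 1 s = F 1 a * a - F 1 b * F 1 (F 1 b)"
    unfolding s_def by (simp only: F_mult F_diff F1_F9)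
  have "F 1 (v * s) = v * s"
    unfolding F_mult F1s using e1' e2' unfolding s_def by algebra
  then have fixd: "F k (v * s) = v * s" for k by (rule F_fixed)
  have "F 5 (v * s) = - (v * s)" unfolding s_def by (simp add: F_mult F_diff comm ab uv F_minus)
  then have "2 * (v * s) = 0" unfolding fixd by (metis add.right_inverse mult_2)
  moreover have ab0: "a \<noteq> 0 \<or> b \<noteq> 0" using x x' by auto
  then have "s \<noteq> 0" using norm_form_neq_0[OF ab] by (simp add: s_def)
  ultimately have v: "v = 0" using two_neq_0 by simp
  have "F 1 u = u"
  proof (cases "a = 0")
    case True with e2' v ab0 show ?thesis by simp
  next
    case False with e1' v show ?thesis by simp
  qed
  then show ?thesis by (simp add: l' v)
qed

section \<open>The subfield of order \<open>q\<close>, bases, and the number of slopes\<close>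

lemma card_nonzero: "card (UNIV - {0::'a}) = q ^ 10 - 1"
  using card_field by (simp add: card_Diff_subset)

text \<open>
  A root count gives at most \<open>q\<close> elements. For the other inequality, the trace takes values in
  the subfield, and each value at most \<open>q ^ 9\<close> times.
\<close>
lemma card_Fq: "card (Fq q :: 'a set) = q"
proof (rule antisym)
  define P :: "'a poly" where "P = monom 1 q - monom 1 1"
  have "coeff P q = 1" using q_ge_5 by (simp add: P_def)
  then have P0: "P \<noteq> 0" by auto
  have "degree P \<le> q" unfolding P_def
    by (rule degree_diff_le) (use q_ge_5 in \<open>auto intro: order.trans[OF degree_monom_le]\<close>)
  moreover have "{x. poly P x = 0} = Fq q" by (auto simp: P_def Fq_def poly_monom)
  ultimately show "card (Fq q :: 'a set) \<le> q" using card_poly_roots_bound[OF P0] by simp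
next
  define Tr :: "'a \<Rightarrow> 'a" where "Tr x = (\<Sum>i<Suc 9. F i x)" for x
  have fibre: "card {x. Tr x = c} \<le> q ^ 9" for c
  proof -
    define P where "P = (\<Sum>i<Suc 9. monom 1 (q ^ i)) - [:c:]"
    have qi: "q ^ i = q ^ 9 \<longleftrightarrow> i = 9" for i using q_ge_5 by simp
    have "coeff P (q ^ 9) = (\<Sum>i<Suc 9. if i = 9 then 1 else 0)"
      using q_ge_5 by (auto simp: P_def coeff_sum qi coeff_pCons split: nat.splits intro!: sum.cong simp del: sum.lessThan_Suc)
    also have "\<dots> = 1" by (subst sum.delta) auto
    finally have P0: "P \<noteq> 0" by auto
    have "degree P \<le> q ^ 9" unfolding P_def
      by (intro degree_diff_le degree_sum_le)
         (use q_ge_5 in \<open>auto intro!: order.trans[OF degree_monom_le] power_increasing\<close>)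
    moreover have "{x. poly P x = 0} = {x. Tr x = c}"
      by (auto simp: P_def Tr_def F_def poly_sum poly_monom simp del: sum.lessThan_Suc)
    ultimately show ?thesis using card_poly_roots_bound[OF P0] by simp
  qed
  have range: "Tr x \<in> Fq q" for x
  proof -
    have "F 1 (Tr x) = (\<Sum>i<Suc 9. F (Suc i) x)" unfolding Tr_def F_sum F_F by (simp only: plus_1_eq_Suc)
    also have "\<dots> = F 10 x + (\<Sum>i<9. F (Suc i) x)" unfolding sum.lessThan_Suc by (simp add: add.commute)
    also have "F 10 x = F 0 x" using F_add_10[of 0 x] by simp
    also have "F 0 x + (\<Sum>i<9. F (Suc i) x) = Tr x" unfolding Tr_def sum.lessThan_Suc_shift ..
    finally show ?thesis by (simp add: Fq_def F_def)
  qed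
  have "q ^ 10 = card (\<Union>c\<in>Fq q. {x. Tr x = c})"
  proof -
    have "(\<Union>c\<in>Fq q. {x. Tr x = c}) = UNIV" using range by blast
    then show ?thesis using card_field by (simp only:)
  qed
  also have "\<dots> \<le> (\<Sum>c\<in>Fq q. card {x. Tr x = c})" by (rule card_UN_le) simp
  also have "\<dots> \<le> card (Fq q :: 'a set) * q ^ 9" using sum_bounded_above[of "Fq q" _ "q^9", OF fibre] by simp
  finally have "q ^ 10 \<le> card (Fq q :: 'a set) * q ^ 9" .
  moreover have "q ^ 10 = q * q ^ 9" using power_Suc[of q 9] by (simp del: power_Suc)
  ultimately have "q * q ^ 9 \<le> card (Fq q :: 'a set) * q ^ 9" by (simp only:)
  then show "q \<le> card (Fq q :: 'a set)" using q_ge_5 by simp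
qed

lemma Fq_iff: "c \<in> Fq q \<longleftrightarrow> F 1 c = c" by (simp add: Fq_def F_def)

lemma Fq_0 [simp]: "(0::'a) \<in> Fq q"
  by (simp add: Fq_iff)

lemma Fq_diff: "(a::'a) \<in> Fq q \<Longrightarrow> b \<in> Fq q \<Longrightarrow> a - b \<in> Fq q"
  by (simp add: Fq_iff F_ring)

lemma Fq_divide: "(a::'a) \<in> Fq q \<Longrightarrow> b \<in> Fq q \<Longrightarrow> a / b \<in> Fq q"
  by (simp add: Fq_iff F_ring)

lemma Fq_minus: "(a::'a) \<in> Fq q \<Longrightarrow> - a \<in> Fq q"
  by (simp add: Fq_iff F_ring)

definition Fq_indep :: "nat \<Rightarrow> (nat \<Rightarrow> 'a) \<Rightarrow> bool" where
  "Fq_indep k b \<longleftrightarrow> (\<forall>c. (\<forall>i<k. c i \<in> Fq q) \<and> (\<Sum>i<k. c i * b i) = 0 \<longrightarrow> (\<forall>i<k. c i = 0))"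

text \<open>
  As long as \<open>k < 10\<close>, the combinations of \<open>k\<close> elements do not exhaust the field.
\<close>
lemma Fq_indep_exists: "k \<le> 10 \<Longrightarrow> \<exists>b. Fq_indep k b"
proof (induction k)
  case 0 show ?case by (simp add: Fq_indep_def)
next
  case (Suc k)
  then obtain b where b: "Fq_indep k b" by auto
  define span where "span = (\<lambda>c. \<Sum>i<k. c i * b i) ` (PiE {..<k} (\<lambda>_. Fq q))"
  have "card span \<le> card (PiE {..<k} (\<lambda>_. Fq q :: 'a set))"
    unfolding span_def by (rule card_image_le) (simp add: finite_PiE)
  also have "\<dots> = q ^ k" by (simp add: card_PiE card_Fq)
  also have "\<dots> < q ^ 10" using Suc.prems q_ge_5 by (intro power_strict_increasing) auto
  finally have "span \<noteq> UNIV" using card_field by auto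
  then obtain v where v: "v \<notin> span" by auto
  have notin: "v \<noteq> (\<Sum>i<k. c i * b i)" if "\<forall>i<k. c i \<in> Fq q" for c
  proof
    assume "v = (\<Sum>i<k. c i * b i)"
    then have "v = (\<Sum>i<k. restrict c {..<k} i * b i)" by simp
    moreover have "restrict c {..<k} \<in> PiE {..<k} (\<lambda>_. Fq q)" using that by simp
    ultimately show False using v unfolding span_def by blast
  qed
  have "Fq_indep (Suc k) (b(k := v))" unfolding Fq_indep_def
  proof (intro allI impI; elim conjE)
    fix c i assume c: "\<forall>i<Suc k. c i \<in> Fq q" and s: "(\<Sum>i<Suc k. c i * (b(k := v)) i) = 0" and i: "i < Suc k"
    have s': "(\<Sum>i<k. c i * b i) + c k * v = 0" using s by simp
    have "c k = 0"
    proof (rule ccontr)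
      assume ck: "c k \<noteq> 0"
      have "c k * v = - (\<Sum>i<k. c i * b i)" using s' by (simp add: add_eq_0_iff)
      then have "v = - (\<Sum>i<k. c i * b i) / c k" using ck by (metis nonzero_mult_div_cancel_left)
      also have "\<dots> = (\<Sum>i<k. - (c i / c k) * b i)"
        unfolding sum_negf[symmetric] sum_divide_distrib by (rule sum.cong) simp_all
      finally have "v = (\<Sum>i<k. - (c i / c k) * b i)" .
      moreover have "\<forall>i<k. - (c i / c k) \<in> Fq q" using c by (auto intro!: Fq_divide Fq_minus)
      ultimately show False using notin[of "\<lambda>i. - (c i / c k)"] by blast
    qed
    moreover from this have "(\<forall>i<k. c i \<in> Fq q) \<and> (\<Sum>i<k. c i * b i) = 0" using c s' by simp
    then have "\<forall>i<k. c i = 0" by (rule b[unfolded Fq_indep_def, THEN spec, THEN mp])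
    ultimately show "c i = 0" using i by (auto simp: less_Suc_eq)
  qed
  then show ?case by blast
qed

lemma Fq_basis_exists:
  "\<exists>b. Fq_indep 10 b \<and> UNIV = {\<Sum>i<10. c i * b i | c. \<forall>i<10. c i \<in> Fq q}"
proof -
  obtain b where b: "Fq_indep 10 b" using Fq_indep_exists by blast
  let ?C = "PiE {..<10} (\<lambda>_. Fq q) :: (nat \<Rightarrow> 'a) set" and ?f = "\<lambda>c. \<Sum>i<10. c i * b i"
  have "inj_on ?f ?C"
  proof (rule inj_onI)
    fix c d assume c: "c \<in> ?C" and d: "d \<in> ?C" and eq: "?f c = ?f d"
    have s: "(\<Sum>i<10. (c i - d i) * b i) = 0" using eq by (simp add: left_diff_distrib sum_subtractf)
    have "\<forall>i<10. c i - d i \<in> Fq q" using c d by (simp add: PiE_iff Fq_diff)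
    then have "(\<forall>i<10. c i - d i \<in> Fq q) \<and> (\<Sum>i<10. (c i - d i) * b i) = 0" using s by (rule conjI)
    then have "\<forall>i<10. c i - d i = 0" by (rule b[unfolded Fq_indep_def, THEN spec, THEN mp])
    then have "c i = d i" if "i \<in> {..<10}" for i 
      by (metis \<open>\<forall>i<10. c i - d i = 0\<close> that lessThan_iff eq_iff_diff_eq_0)
    then show "c = d" by (rule PiE_ext[OF c d])
  qed
  then have "card (?f ` ?C) = q ^ 10" by (simp add: card_image card_PiE card_Fq)
  then have all: "?f ` ?C = UNIV" using card_field by (intro card_subset_eq) auto
  have "?f ` ?C \<subseteq> {\<Sum>i<10. c i * b i | c. \<forall>i<10. c i \<in> Fq q}"
  proof (rule image_subsetI)
    fix c assume "c \<in> ?C"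
    then have "\<forall>i<10. c i \<in> Fq q" by (simp add: PiE_iff)
    then show "?f c \<in> {\<Sum>i<10. c i * b i | c. \<forall>i<10. c i \<in> Fq q}" by blast
  qed
  then have "UNIV = {\<Sum>i<10. c i * b i | c. \<forall>i<10. c i \<in> Fq q}" unfolding all by (rule top_le[THEN sym])
  with b have "Fq_indep 10 b \<and> UNIV = {\<Sum>i<10. c i * b i | c. \<forall>i<10. c i \<in> Fq q}" by (rule conjI)
  then show ?thesis by (intro exI[of _ b])
qed

definition slopes :: "'a set" where "slopes = (\<lambda>x. psi x / x) ` (UNIV - {0})"

text \<open>
  By scatteredness, a slope determines \<open>x\<close> up to a nonzero factor from the subfield of order \<open>q\<close>.
\<close>
lemma card_slopes_mult: "card slopes * (q - 1) = q ^ 10 - 1"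
proof -
  have fibre: "card {x \<in> UNIV - {0}. psi x / x = m} = q - 1" if "m \<in> slopes" for m
  proof -
    obtain x where x: "x \<noteq> 0" "m = psi x / x" using \<open>m \<in> slopes\<close> by (auto simp: slopes_def)
    have "{y \<in> UNIV - {0}. psi y / y = m} = (\<lambda>c. c * x) ` (Fq q - {0})"
    proof (intro equalityI subsetI)
      fix y assume "y \<in> {y \<in> UNIV - {0}. psi y / y = m}"
      then have y: "y \<noteq> 0" "psi y / y = psi x / x" using x by auto
      then have "psi ((y / x) * x) = (y / x) * psi x" using x(1) by (simp add: field_simps)
      then have "F 1 (y / x) = y / x" by (rule scattered[OF x(1)])
      then have "y / x \<in> Fq q - {0}" using x(1) y(1) by (simp add: Fq_iff)
      moreover have "y = (y / x) * x" using x by simp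
      ultimately show "y \<in> (\<lambda>c. c * x) ` (Fq q - {0})" by (rule rev_image_eqI)
    next
      fix y assume "y \<in> (\<lambda>c. c * x) ` (Fq q - {0})"
      then obtain c where "y = c * x" "F 1 c = c" "c \<noteq> 0" unfolding Fq_iff[symmetric] by blast
      then show "y \<in> {y \<in> UNIV - {0}. psi y / y = m}" using x by (simp add: psi_scale)
    qed
    moreover have "inj_on (\<lambda>c. c * x) (Fq q - {0})" using x by (auto intro: inj_onI)
    ultimately show ?thesis using card_Fq Fq_0 by (simp add: card_image)
  qed
  have "card (UNIV - {0::'a}) = (\<Sum>m\<in>slopes. card {x \<in> UNIV - {0}. psi x / x = m})"
    using sum.group[of "UNIV - {0::'a}" slopes "\<lambda>x. psi x / x" "\<lambda>_. 1::nat"] by (simp add: slopes_def)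
  then show ?thesis using fibre card_nonzero by simp
qed

section \<open>The linear set of \<open>\<psi>\<close>\<close>

lemma geometric: "(\<Sum>i<10. q ^ i) * (q - 1) = q ^ 10 - 1"
proof -
  have "(\<Sum>i<n. q ^ i) * (q - 1) + 1 = q ^ n" for n
  proof (induction n)
    case (Suc n)
    have "q ^ n * (q - 1) + q ^ n = q ^ n * ((q - 1) + 1)" by (simp only: distrib_left mult_1_right)
    also have "\<dots> = q ^ Suc n" using q_ge_5 by simp
    finally show ?case using Suc by (simp add: distrib_right)
  qed simp
  from this[of 10] show ?thesis by simp
qed

lemma card_slopes: "card slopes = (\<Sum>i<10. q ^ i)" "(\<Sum>i<10. q ^ i) = (q ^ 10 - 1) div (q - 1)"
proof -
  have "card slopes * (q - 1) = (\<Sum>i<10. q ^ i) * (q - 1)" using geometric card_slopes_mult by simp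
  then show "card slopes = (\<Sum>i<10. q ^ i)" using q_ge_5 by simp
  show "(\<Sum>i<10. q ^ i) = (q ^ 10 - 1) div (q - 1)" unfolding geometric[symmetric] using q_ge_5 by simp
qed

lemma geometric_less: "(\<Sum>i<10. q ^ i) < CARD('a)"
proof -
  have "(\<Sum>i<10. q ^ i) * 1 \<le> (\<Sum>i<10. q ^ i) * (q - 1)" using q_ge_5 by (intro mult_left_mono) auto
  also have "\<dots> < q ^ 10" unfolding geometric using q_ge_5 by simp
  finally show ?thesis by (simp add: card_field)
qed


lemma span_slope:
  assumes "(x::'a) \<noteq> 0" shows "vec.span {vector [x, y] :: 'a ^ 2} = vec.span {vector [1, y / x]}"
proof -
  define w :: "'a ^ 2" where "w = vector [1, y / x]"
  have "vector [x, y] = x *s w"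
    using assms by (simp add: w_def vec_eq_iff forall_2)
  moreover have "vec.span {x *s w} = vec.span {w}"
  proof
    show "vec.span {x *s w} \<subseteq> vec.span {w}"
      by (intro vec.span_minimal) (simp_all add: vec.span_scale vec.span_base)
    have "(1 / x) *s (x *s w) \<in> vec.span {x *s w}" by (intro vec.span_scale vec.span_base) simp
    then have "w \<in> vec.span {x *s w}" using assms by simp
    then show "vec.span {w} \<subseteq> vec.span {x *s w}" by (intro vec.span_minimal) simp_all
  qed
  ultimately show ?thesis by (simp add: w_def)
qed

lemma span_slope_inj: "inj (\<lambda>m::'a. vec.span {vector [1, m] :: 'a ^ 2})"
proof (rule injI)
  fix m n :: 'a assume "vec.span {vector [1, m] :: 'a ^ 2} = vec.span {vector [1, n]}"
  moreover have "vector [1, m] \<in> vec.span {vector [1, m] :: 'a ^ 2}" by (rule vec.span_base) simp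
  ultimately have "vector [1, m] \<in> vec.span {vector [1, n] :: 'a ^ 2}" by (simp only:)
  then obtain k where "vector [1, m] = k *s (vector [1, n] :: 'a ^ 2)" unfolding vec.span_singleton by blast
  then show "m = n" by (simp add: vec_eq_iff forall_2)
qed

lemma lin_set_psi: "lin_set (psi10 q) = (\<lambda>m. vec.span {vector [1, m] :: 'a ^ 2}) ` slopes"
proof -
  have "lin_set (psi10 q) = (\<lambda>x. vec.span {vector [x, psi x] :: 'a ^ 2}) ` (UNIV - {0})"
    unfolding lin_set_def poly_psi10 setcompr_eq_image by (rule arg_cong2[where f = image]) auto
  also have "\<dots> = (\<lambda>x. vec.span {vector [1, psi x / x] :: 'a ^ 2}) ` (UNIV - {0})"
    by (rule image_cong[OF refl]) (rule span_slope, simp)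
  finally show ?thesis unfolding slopes_def image_image .
qed

lemma lin_set_subset_points: "lin_set (f :: 'a poly) \<subseteq> pg1_points"
proof
  fix P assume "P \<in> lin_set f"
  then obtain x where x: "x \<noteq> 0" "P = vec.span {vector [x, poly f x] :: 'a ^ 2}" unfolding lin_set_def by blast
  have "vector [x, poly f x] \<noteq> (0 :: 'a ^ 2)" using x(1) by (auto simp: vec_eq_iff forall_2)
  then have "vec.dim P = 1" unfolding x(2) vec.dim_span by (subst vec.dim_eq_card_independent) simp_all
  then show "P \<in> pg1_points" using x(2) by (simp add: pg1_points_def)
qed

lemma psi_sum: "psi (sum f S) = (\<Sum>i\<in>S. psi (f i))"
proof (induction S rule: infinite_finite_induct)
  case (insert x S) then show ?case by (simp add: psi_add)
qed (simp_all add: psi_def)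

lemma is_linear_set_psi: "is_linear_set q 10 (lin_set (psi10 q) :: ('a ^ 2) set set)"
proof -
  obtain b where b: "Fq_indep 10 b" and gen: "UNIV = {\<Sum>i<10. c i * b i | c. \<forall>i<10. c i \<in> Fq q}"
    using Fq_basis_exists by (elim exE conjE)
  define v :: "'a \<Rightarrow> 'a ^ 2" where "v x = vector [x, psi x]" for x
  have comb: "(\<Sum>i<10. c i *s v (b i)) = v (\<Sum>i<10. c i * b i)" if c: "\<forall>i<10. c i \<in> Fq q" for c
  proof -
    have "(\<Sum>i<10. c i * psi (b i)) = psi (\<Sum>i<10. c i * b i)"
      unfolding psi_sum using c by (intro sum.cong) (simp_all add: psi_scale Fq_iff)
    then show ?thesis by (simp add: v_def vec_eq_iff forall_2)
  qed
  have gen_v: "range v = {\<Sum>i<10. c i *s v (b i) | c. \<forall>i<10. c i \<in> Fq q}"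
  proof (intro equalityI subsetI)
    fix u assume "u \<in> range v"
    then obtain x where x: "u = v x" by auto
    have "x \<in> {\<Sum>i<10. c i * b i | c. \<forall>i<10. c i \<in> Fq q}" using gen by (metis UNIV_I)
    then obtain c where c: "x = (\<Sum>i<10. c i * b i)" "\<forall>i<10. c i \<in> Fq q" by auto
    have "u = (\<Sum>i<10. c i *s v (b i))" unfolding x c(1) comb[OF c(2)] ..
    then show "u \<in> {\<Sum>i<10. c i *s v (b i) | c. \<forall>i<10. c i \<in> Fq q}" using c(2) by blast
  next
    fix u assume "u \<in> {\<Sum>i<10. c i *s v (b i) | c. \<forall>i<10. c i \<in> Fq q}"
    then obtain c where c: "u = (\<Sum>i<10. c i *s v (b i))" "\<forall>i<10. c i \<in> Fq q" by auto
    then show "u \<in> range v" using comb[OF c(2)] by (simp only: rangeI)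
  qed
  have indep_v: "\<forall>c. (\<forall>i<10. c i \<in> Fq q) \<and> (\<Sum>i<10. c i *s v (b i)) = 0 \<longrightarrow> (\<forall>i<10. c i = 0)"
  proof (rule allI, rule impI, erule conjE)
    fix c assume c: "\<forall>i<10. c i \<in> Fq q" and z: "(\<Sum>i<10. c i *s v (b i)) = 0"
    have "v (\<Sum>i<10. c i * b i) = 0" using z comb[OF c] by simp
    then have "(\<Sum>i<10. c i * b i) = 0" by (simp add: v_def vec_eq_iff forall_2)
    with c have "(\<forall>i<10. c i \<in> Fq q) \<and> (\<Sum>i<10. c i * b i) = 0" by (rule conjI)
    then show "\<forall>i<10. c i = 0" by (rule b[unfolded Fq_indep_def, THEN spec, THEN mp])
  qed
  have "Fq_subspace_of_dim q 10 (range v)"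
    unfolding Fq_subspace_of_dim_def using gen_v indep_v by (intro exI[of _ "\<lambda>i. v (b i)"] conjI)
  moreover have "v x = 0 \<longleftrightarrow> x = 0" for x
    by (auto simp: v_def vec_eq_iff forall_2 psi_def)
  then have "lin_set (psi10 q) = {vec.span {u} | u. u \<in> range v \<and> u \<noteq> 0}"
    unfolding lin_set_def poly_psi10 v_def[symmetric] by auto
  ultimately have "Fq_subspace_of_dim q 10 (range v) \<and> lin_set (psi10 q) = {vec.span {u} | u. u \<in> range v \<and> u \<noteq> 0}"
    by (rule conjI)
  then show ?thesis unfolding is_linear_set_def by (rule exI[of _ "range v"])
qed

lemma maximum_scattered_psi: "maximum_scattered q 10 (lin_set (psi10 q) :: ('a ^ 2) set set)"
proof -
  have "card (lin_set (psi10 q) :: ('a ^ 2) set set) = card slopes"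
    unfolding lin_set_psi by (rule card_image) (rule inj_on_subset[OF span_slope_inj subset_UNIV])
  then show ?thesis
    unfolding maximum_scattered_def 
    using is_linear_set_psi lin_set_subset_points[of "psi10 q"] card_slopes by simp
qed


text \<open>
  The multiplier of the \<open>i\<close>-th transfer step is \<open>F i n\<close> with \<open>n = a * F 9 a - b * F 1 b\<close>. It is nonzero by
  \<open>norm_form_neq_0\<close>, which is what the eigenvalue argument needs.
\<close>
lemma psi_form_vanishes_graph:
  assumes x: "x \<noteq> 0" shows "psi_form (\<lambda>i. (F i x, F i (psi x))) = 0"
proof -
  define a b where "a = half_plus x" and "b = half_minus x"
  have ab: "F 5 a = a" "F 5 b = - b" "x = a + b" "psi x = F 9 a + F 1 b"
    unfolding a_def b_def psi_half by (simp_all add: F5_half half_sum)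
  have nz: "a \<noteq> 0 \<or> b \<noteq> 0" using x ab(3) by auto
  define n where "n = a * F 9 a - b * F 1 b"
  have n0: "n \<noteq> 0" unfolding n_def using norm_form_neq_0[OF ab(1,2) nz] by simp
  define T where "T i = psi_transfer (F i x, F i (psi x)) (F (i + 5) x, F (i + 5) (psi x))" for i
  define R where "R = mat2_prod T 5"
  have shift: "F (Suc i + 9) a = F i a" for i
  proof -
    have "Suc i + 9 = i + 10" by simp
    then show ?thesis by (simp only: F_add_10)
  qed
  have T: "T i = (let u = F i a; w = F i b; v = F (i + 9) a; c = F (Suc i) b in
      Mat2 (u * u - w * w) (- (u * c - v * w)) (u * c - v * w) (v * v - c * c))" for i
  proof -
    have 5: "F (i + 5) a = F i a" "F (i + 5) b = - F i b" "F (i + 5) (F 9 a) = F (i + 9) a"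
      "F (i + 5) (F 1 b) = - F (Suc i) b"
      using arg_cong[OF ab(1), of "F i"] arg_cong[OF ab(2), of "F i"]
        arg_cong[OF ab(1), of "F (i + 9)"] arg_cong[OF ab(2), of "F (Suc i)"]
      by (simp_all add: F_F F_minus algebra_simps)
    have 0: "F i (F 9 a) = F (i + 9) a" "F i (F 1 b) = F (Suc i) b" by (simp_all add: F_F)
    show ?thesis
      unfolding T_def psi_transfer_def ab(4) unfolding ab(3) F_add 5 0 Let_def
      using two_neq_0 by (simp add: field_simps)
  qed
  have chain: "e11 R * F (0 + 9) a + e12 R * F 0 b = (\<Prod>i<5. F i n) * F (5 + 9) a \<and>
    e21 R * F (0 + 9) a + e22 R * F 0 b = (\<Prod>i<5. F i n) * F 5 b"
    unfolding R_def
  proof (rule mat2_prod_chain[where x = "\<lambda>i. F (i + 9) a" and y = "\<lambda>i. F i b"])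
    fix i :: nat
    have n: "F i n = F i a * F (i + 9) a - F i b * F (Suc i) b" by (simp add: n_def F_ring)
    show "e11 (T i) * F (i + 9) a + e12 (T i) * F i b = F i n * F (Suc i + 9) a"
      unfolding shift n T Let_def by (simp add: algebra_simps)
    show "e21 (T i) * F (i + 9) a + e22 (T i) * F i b = F i n * F (Suc i) b"
      unfolding n T Let_def by (simp add: algebra_simps)
  qed
  have det: "mat2_det R = (\<Prod>i<5. F i n) * (\<Prod>i<5. F i n)"
    unfolding R_def mat2_det_prod prod.distrib[symmetric]
  proof (rule prod.cong)
    fix i :: nat
    have n: "F i n = F i a * F (i + 9) a - F i b * F (Suc i) b" by (simp add: n_def F_ring)
    show "mat2_det (T i) = F i n * F i n" unfolding n T Let_def by (simp add: algebra_simps)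
  qed simp
  have a14: "F (5 + 9) a = F 9 a" using arg_cong[OF ab(1), of "F 9"] by (simp add: F_F)
  have "e11 R = e22 R"
  proof (rule eigenvector_trace)
    show "e11 R * F 9 a + e12 R * F 0 b = (\<Prod>i<5. F i n) * F 9 a"
      "e21 R * F 9 a + e22 R * F 0 b = - ((\<Prod>i<5. F i n) * F 0 b)"
      using chain unfolding a14 ab(2) F_zero by simp_all
    show "(\<Prod>i<5. F i n) \<noteq> 0" using n0 by simp
    show "F 9 a \<noteq> 0 \<or> F 0 b \<noteq> 0" using nz by simp
  qed (rule det)
  then show ?thesis unfolding psi_form_def R_def T_def Let_def by simp
qed

lemma psi_form_vanishes:
  assumes "z \<in> slopes" shows "psi_form (\<lambda>i. (1, z ^ q ^ i)) = 0"
proof -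
  obtain x where x: "x \<noteq> 0" "z = psi x / x" using assms by (auto simp: slopes_def)
  have "(\<lambda>i. (1, z ^ q ^ i)) = (\<lambda>i. (F i (1 / x) * fst (F i x, F i (psi x)), F i (1 / x) * snd (F i x, F i (psi x))))"
    using x(1) by (simp add: x(2) F_def power_divide)
  then show ?thesis
    using multilinear_on_scale_args[OF multilinear_psi_form, of "\<lambda>i. F i (1 / x)" "\<lambda>i. (F i x, F i (psi x))"]
    by (simp add: psi_form_vanishes_graph[OF x(1)])
qed

section \<open>Inequivalence\<close>

lemma F_cong: "j mod 10 = k mod 10 \<Longrightarrow> F j x = F k x"
  using F_mod[of j x] F_mod[of k x] by simp

lemma lp_form_vanishes_graph:
  assumes s: "s \<in> {1, 3, 7, 9}" and y: "y \<noteq> 0" and m: "m \<noteq> 0"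
  shows "lp_form (\<lambda>p. F (s * p) \<delta>) (\<lambda>p. (F (s * p) (m * y), F (s * p) (m * (\<delta> * F s y + F (10 - s) y)))) = 0"
proof -
  define z where "z p = F (s * p + (10 - s)) y" for p
  have z0: "z 0 = F (s * 9) y"
    unfolding z_def by (rule F_cong) (simp add: multiples_mod_10(4)[OF s])
  have zS: "z (Suc p) = F (s * p) y" for p
  proof -
    have "s * Suc p + (10 - s) = s * p + 10" using s by auto
    then show ?thesis unfolding z_def by (simp only: F_add_10)
  qed
  have y10: "F (s * 10) y = F (s * 0) y" by (rule F_cong) simp
  have c: "(F (s * p) (m * y), F (s * p) (m * (\<delta> * F s y + F (10 - s) y))) =
    (F (s * p) m * F (s * p) y, F (s * p) m * (F (s * p) \<delta> * F (s * Suc p) y + z p))" for p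
    by (simp add: F_mult F_add F_F z_def add.commute)
  show ?thesis
  proof (cases "\<delta> = 0")
    case True
    show ?thesis unfolding True F_0
    proof (rule lp_form_zero_vanishes)
      show "(F (s * p) (m * y), F (s * p) (m * (0 * F s y + F (10 - s) y))) =
        (F (s * p) m * F (s * p) y, F (s * p) m * z p)" for p using c[of p] True by simp
    qed (use z0 zS in auto)
  next
    case False
    show ?thesis
    proof (rule lp_form_vanishes[where y = "\<lambda>p. F (s * p) y" and z = z and m = "\<lambda>p. F (s * p) m"])
      show "(\<Prod>p<10. F (s * p) \<delta>) \<noteq> 0" using False by simp
    qed (use y m in \<open>auto simp: c z0 zS y10\<close>)
  qed
qed

text \<open>
  The field automorphism commutes with \<open>\<psi>\<close>, whose coefficients lie in the prime field, so only the
  matrix \<open>A\<close> remains. It acts on the argument with index \<open>i\<close> through its conjugate under \<open>F i\<close>.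
\<close>
lemma no_equivalence:
  fixes g :: "'a poly"
  assumes s: "s \<in> {1, 3, 7, 9}" and g: "\<And>x. poly g x = \<delta> * F s x + F (10 - s) x"
  shows "\<not> PGammaL_equivalent (lin_set (psi10 q)) (lin_set g)"
proof
  assume "PGammaL_equivalent (lin_set (psi10 q)) (lin_set g)"
  then obtain A :: "'a ^ 2 ^ 2" and \<sigma> where inv: "invertible A" and \<sigma>: "field_automorphism \<sigma>"
    and im: "restrict ((`) (\<lambda>v. A *v (\<chi> i. \<sigma> (v $ i)))) pg1_points ` lin_set (psi10 q) = lin_set g"
    unfolding PGammaL_equivalent_def PGammaL2_def GammaL2_def by blast
  define h where "h = (\<lambda>v. A *v (\<chi> i. \<sigma> (v $ i)))"
  have \<sigma>_add: "\<sigma> (x + y) = \<sigma> x + \<sigma> y" and \<sigma>_mult: "\<sigma> (x * y) = \<sigma> x * \<sigma> y"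
    and \<sigma>_1: "\<sigma> 1 = 1" and surj: "surj \<sigma>" for x y
    using \<sigma> by (auto simp: field_automorphism_def bij_def)
  have \<sigma>_0: "\<sigma> 0 = 0" using \<sigma>_add[of 0 0] by (metis add.right_neutral add_left_cancel)
  have \<sigma>_diff: "\<sigma> (x - y) = \<sigma> x - \<sigma> y" for x y
    using \<sigma>_add[of "x - y" y] by (simp add: eq_diff_eq)
  have \<sigma>_F: "\<sigma> (F k x) = F k (\<sigma> x)" for k x
  proof -
    have "\<sigma> (x ^ n) = \<sigma> x ^ n" for n by (induction n) (simp_all add: \<sigma>_1 \<sigma>_mult)
    then show ?thesis by (simp add: F_def)
  qed
  have \<sigma>_2: "\<sigma> 2 = 2" using \<sigma>_add[of 1 1] by (simp add: \<sigma>_1)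
  have \<sigma>_psi: "\<sigma> (psi x) = psi (\<sigma> x)" for x
  proof -
    have "2 * \<sigma> (psi x) = \<sigma> (2 * psi x)" by (simp add: \<sigma>_mult \<sigma>_2)
    also have "2 * psi x = F 1 x + F 4 x - F 6 x + F 9 x" using two_neq_0 by (simp add: psi_def)
    also have "\<sigma> \<dots> = 2 * psi (\<sigma> x)" using two_neq_0 by (simp add: \<sigma>_add \<sigma>_diff \<sigma>_F psi_def)
    finally show ?thesis using two_neq_0 by simp
  qed
  define a b c e where "a = A $ 1 $ 1" and "b = A $ 1 $ 2" and "c = A $ 2 $ 1" and "e = A $ 2 $ 2"
  define D where "D = a * e - b * c"
  have D: "D \<noteq> 0" using inv unfolding invertible_det_nz det_2 D_def a_def b_def c_def e_def .
  have image: "\<exists>y m. y \<noteq> 0 \<and> m \<noteq> 0 \<and> a * x + b * psi x = m * y \<and> c * x + e * psi x = m * poly g y"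
    if x: "x \<noteq> 0" for x
  proof -
    obtain x' where x': "x = \<sigma> x'" using surj by (metis surjD)
    then have "x' \<noteq> 0" using x \<sigma>_0 by auto
    define P where "P = vec.span {vector [x', psi x'] :: 'a ^ 2}"
    have P: "P \<in> lin_set (psi10 q)" unfolding P_def lin_set_def poly_psi10 using \<open>x' \<noteq> 0\<close> by blast
    then have "P \<in> pg1_points" using lin_set_subset_points by blast
    then have "h ` P \<in> lin_set g" using P im unfolding h_def[symmetric] by (metis image_eqI restrict_apply)
    then obtain y where y: "y \<noteq> 0" "h ` P = vec.span {vector [y, poly g y]}" unfolding lin_set_def by blast
    have "vector [x', psi x'] \<in> P" unfolding P_def by (rule vec.span_base) simp
    then have "h (vector [x', psi x']) \<in> vec.span {vector [y, poly g y]}" unfolding y(2)[symmetric] by (rule imageI)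
    then obtain m where m: "h (vector [x', psi x']) = m *s vector [y, poly g y]"
      unfolding vec.span_singleton by blast
    have eqs: "a * x + b * psi x = m * y" "c * x + e * psi x = m * poly g y"
      using arg_cong[OF m, of "\<lambda>v. v $ 1"] arg_cong[OF m, of "\<lambda>v. v $ 2"]
      by (simp_all add: h_def matrix_vector_mult_def sum_2 a_def b_def c_def e_def x' \<sigma>_psi)
    have "m \<noteq> 0"
    proof
      assume "m = 0"
      then have "D * x = 0" using eqs unfolding D_def by (simp, algebra)
      then show False using D x by simp
    qed
    then show ?thesis using y(1) eqs by blast
  qed
  define idx where "idx p = s * p mod 10" for p
  note idx = multiples_mod_10(1,2)[OF s, folded idx_def]
  have idx0: "idx 0 = 0" and idx5: "idx 5 = 5" by (simp_all add: idx_def multiples_mod_10(3)[OF s])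
  have F_idx: "F (idx p) x = F (s * p) x" for p x unfolding idx_def by (rule F_mod)
  define d where "d p = F (s * p) \<delta>" for p
  \<comment> \<open>the conjugate of \<open>A\<close> acting on the \<open>i\<close>-th argument, and its inverse\<close>
  define A_at where "A_at i x = (F i a * fst x + F i b * snd x, F i c * fst x + F i e * snd x)" for i x
  define B_at where "B_at i x = ((F i e * fst x - F i b * snd x) / F i D, (F i a * snd x - F i c * fst x) / F i D)" for i x
  have AB: "A_at i (B_at i x) = x" for i x
  proof -
    have D_i: "F i D = F i a * F i e - F i b * F i c" by (simp add: D_def F_ring)
    have "F i D \<noteq> 0" using D by simp
    obtain u v where x: "x = (u, v)" by (cases x)
    have "F i a * (F i e * u - F i b * v) + F i b * (F i a * v - F i c * u) = F i D * u"
      "F i c * (F i e * u - F i b * v) + F i e * (F i a * v - F i c * u) = F i D * v"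
      unfolding D_i by algebra+
    then show ?thesis using \<open>F i D \<noteq> 0\<close>
      by (simp add: A_at_def B_at_def x add_divide_distrib[symmetric])
  qed
  define H where "H w = lp_form d (\<lambda>p. A_at (idx p) (w (idx p)))" for w
  have H_multilinear: "multilinear_on {..<10} H"
    unfolding H_def A_at_def
    by (rule multilinear_on_subst[OF multilinear_lp_form[OF idx]])
  have H_vanishes: "H (\<lambda>i. (1, z ^ q ^ i)) = 0" if "z \<in> slopes" for z
  proof -
    obtain x where x: "x \<noteq> 0" "z = psi x / x" using \<open>z \<in> slopes\<close> by (auto simp: slopes_def)
    obtain y m where ym: "y \<noteq> 0" "m \<noteq> 0" "a * x + b * psi x = m * y" "c * x + e * psi x = m * poly g y"
      using image[OF x(1)] by blast
    have "a + b * z = m / x * y" "c + e * z = m / x * poly g y"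
      using ym(3,4) x by (simp_all add: field_simps)
    then have "F i a + F i b * F i z = F i (m / x * y)" "F i c + F i e * F i z = F i (m / x * poly g y)" for i
      by (metis F_add F_mult)+
    then have "A_at i (1, z ^ q ^ i) = (F i (m / x * y), F i (m / x * poly g y))" for i
      unfolding F_def[symmetric] by (simp add: A_at_def)
    then show ?thesis unfolding H_def g d_def
      using lp_form_vanishes_graph[OF s ym(1), of "m / x" \<delta>] ym(2) x(1) by (simp add: F_idx)
  qed
  have nonzero: "psi_form ((\<lambda>_. (1, 0))(0 := (1, 0), 5 := (1, 0))) \<noteq> (0::'a)" unfolding psi_form_values by simp
  have "\<exists>k. \<forall>w. H w = k * psi_form w"
    by (rule multilinear_proportional[OF _ geometric_less H_multilinear multilinear_psi_form
          card_slopes(1) H_vanishes psi_form_vanishes nonzero]) (use q_ge_5 in simp)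
  then obtain k where k: "H w = k * psi_form w" for w by (elim exE) blast
  \<comment> \<open>since the conjugates are invertible, the arguments at positions other than 0 and 5 can be prescribed\<close>
  have lift: "\<exists>w. \<forall>x y. H (w(0 := x, 5 := y)) = lp_form d (t(0 := A_at 0 x, 5 := A_at 5 y))" for t
  proof -
    define w where "w i = B_at i (t (inv_into {..<10} idx i))" for i
    have "H (w(0 := x, 5 := y)) = lp_form d (t(0 := A_at 0 x, 5 := A_at 5 y))" for x y
      unfolding H_def
    proof (rule lp_form_cong)
      fix p :: nat assume p: "p < 10"
      have "idx p = 0 \<longleftrightarrow> p = 0" "idx p = 5 \<longleftrightarrow> p = 5"
        using inj_on_eq_iff[OF idx(1), of p 0] inj_on_eq_iff[OF idx(1), of p 5] p idx0 idx5 by auto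
      moreover have "inv_into {..<10} idx (idx p) = p" using idx(1) p by simp
      ultimately show "A_at (idx p) ((w(0 := x, 5 := y)) (idx p)) = (t(0 := A_at 0 x, 5 := A_at 5 y)) p"
        by (auto simp: w_def AB idx0 idx5)
    qed
    then show ?thesis by blast
  qed
  have D5: "F 5 D = F 5 a * F 5 e - F 5 b * F 5 c" "F 5 D \<noteq> 0"
    subgoal by (simp add: D_def F_ring)
    subgoal using D by simp
    done
  show False
  proof (cases "\<delta> = 0")
    case False
    \<comment> \<open>the linear condition on the bilinear forms of \<open>\<psi>\<close>, transported by \<open>A\<close>: the products $u v'$ and $u u'$
      turn it into two linear equations for the first row \<open>(a, b)\<close>\<close>
    have anti: "lp_form d (t(0 := A_at 0 (1, 0), 5 := A_at 5 (0, 1))) + lp_form d (t(0 := A_at 0 (0, 1), 5 := A_at 5 (1, 0))) = 0" for t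
    proof -
      obtain w where "\<And>x y. H (w(0 := x, 5 := y)) = lp_form d (t(0 := A_at 0 x, 5 := A_at 5 y))" using lift by blast
      then show ?thesis using psi_form_antisymmetric[of w] unfolding k by (metis distrib_left mult_zero_right)
    qed
    have d0: "d 0 \<noteq> 0" "d 5 \<noteq> 0" using False by (simp_all add: d_def)
    have "- d 0 * (a * F 5 e + b * F 5 c) = 0" "d 0 * d 5 * (a * F 5 b + b * F 5 a) = 0"
      using anti[of "\<lambda>p. if p = 1 then (1, 0) else (0, 1)"] anti[of "\<lambda>p. if p = 1 \<or> p = 6 then (1, 0) else (0, 1)"]
      unfolding lp_form_values by (simp_all add: A_at_def F_zero algebra_simps)
    then have e1: "a * F 5 e + b * F 5 c = 0" and e2: "a * F 5 b + b * F 5 a = 0" using d0 by simp_all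
    have "a * F 5 D = 0" using e1 e2 unfolding D5(1) by algebra
    moreover have "b * F 5 D = 0" using e1 e2 unfolding D5(1) by algebra
    ultimately show False using D5(2) D by (simp add: D_def)
  next
    case True
    then have d: "d = (\<lambda>_. 0)" by (simp add: d_def fun_eq_iff)
    have "H (\<lambda>i. B_at i (0, 1)) = 1" by (simp add: H_def AB lp_form_zero[OF d])
    then have k0: "k \<noteq> 0" using k by auto
    \<comment> \<open>vectors mapped to multiples of \<open>(1, 0)\<close> and \<open>(0, 1)\<close>, on which $u u'$ and $v v'$ both vanish\<close>
    have van: "psi_form (w(0 := (e, - c), 5 := (- F 5 b, F 5 a))) = 0" for w
    proof -
      define v where "v = w(0 := (e, - c), 5 := (- F 5 b, F 5 a))"
      have "snd (A_at (idx 0) (v (idx 0))) = 0" "fst (A_at (idx 5) (v (idx 5))) = 0"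
        by (simp_all add: idx0 idx5 v_def A_at_def F_zero)
      then have "(\<Prod>p<10. snd (A_at (idx p) (v (idx p)))) = 0 \<and> (\<Prod>p<10. fst (A_at (idx p) (v (idx p)))) = 0"
        using prod_zero[of "{..<10}" "\<lambda>p. snd (A_at (idx p) (v (idx p)))"]
          prod_zero[of "{..<10}" "\<lambda>p. fst (A_at (idx p) (v (idx p)))"] by fastforce
      then have "H v = 0" unfolding H_def lp_form_zero[OF d] by (elim conjE) (simp only: diff_self)
      then show ?thesis using k k0 v_def by simp
    qed
    have "(4::'a) = 2 * 2" by simp
    then have "(4::'a) \<noteq> 0" using two_neq_0 by (metis mult_eq_0_iff)
    then have "e * F 5 b = 0" "c * F 5 a = 0" "c * F 5 b = e * F 5 a"
      using van[of "\<lambda>_. (1, 0)"] van[of "\<lambda>_. (0, 1)"] van[of "\<lambda>i. if i \<in> {3, 4, 9} then (1, 0) else (0, 1)"] two_neq_0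
      unfolding psi_form_values by simp_all
    then show False using D5 D unfolding D_def by (cases "e = 0") auto
  qed
qed

end

theorem corollary4p7:
  fixes q :: nat and \<psi> :: "'a::{field,finite} poly"
  assumes "primepow q" and "q mod 4 = 1"
    and "CARD('a) = q ^ 10"
    and "\<psi> = psi10 q"
  shows "maximum_scattered q 10 (lin_set \<psi>)
    \<and> (\<forall>s. 1 \<le> s \<and> s \<le> 9 \<and> gcd s 10 = 1 \<longrightarrow>
          \<not> PGammaL_equivalent (lin_set \<psi>) (lin_set (monom 1 (q ^ s))))
    \<and> (\<forall>s \<delta>. 1 \<le> s \<and> s \<le> 9 \<and> gcd s 10 = 1 \<and> field_norm q 10 \<delta> \<notin> {0, 1} \<longrightarrow>
          \<not> PGammaL_equivalent (lin_set \<psi>)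
              (lin_set (monom \<delta> (q ^ s) + monom 1 (q ^ (10 - s)))))"
proof -
  interpret degree_ten q "TYPE('a)" using assms(1-3) by unfold_locales
  have ineq: "\<not> PGammaL_equivalent (lin_set (psi10 q)) (lin_set (monom \<delta> (q ^ s) + monom 1 (q ^ (10 - s))))"
    if "1 \<le> s" "s \<le> 9" "gcd s 10 = 1" for s and \<delta> :: 'a
    by (rule no_equivalence[OF coprime_10_cases[OF that], where \<delta> = \<delta>]) (simp add: poly_monom F_def)
  have ineq': "\<not> PGammaL_equivalent (lin_set (psi10 q)) (lin_set (monom (1::'a) (q ^ s)))"
    if s: "1 \<le> s" "s \<le> 9" "gcd s 10 = 1" for s
  proof (rule no_equivalence[where \<delta> = 0 and s = "10 - s"])
    show "10 - s \<in> {1, 3, 7, 9}" using coprime_10_cases[OF s] by auto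
    show "poly (monom 1 (q ^ s)) x = 0 * F (10 - s) x + F (10 - (10 - s)) x" for x :: 'a
      using s(2) by (simp add: poly_monom F_def)
  qed
  show ?thesis unfolding assms(4)
  proof (intro conjI allI impI)
    show "maximum_scattered q 10 (lin_set (psi10 q) :: ('a ^ 2) set set)" by (rule maximum_scattered_psi)
  next
    fix s :: nat assume "1 \<le> s \<and> s \<le> 9 \<and> gcd s 10 = 1"
    then show "\<not> PGammaL_equivalent (lin_set (psi10 q)) (lin_set (monom (1::'a) (q ^ s)))"
      by (elim conjE) (rule ineq')
  next
    fix s :: nat and \<delta> :: 'a
    assume "1 \<le> s \<and> s \<le> 9 \<and> gcd s 10 = 1 \<and> field_norm q 10 \<delta> \<notin> {0, 1}"
    then show "\<not> PGammaL_equivalent (lin_set (psi10 q))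
        (lin_set (monom \<delta> (q ^ s) + monom 1 (q ^ (10 - s))))"
      by (elim conjE) (rule ineq)
  qed
qed

end
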